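(* Let $\Theta=(\theta_m)_{m\ge 1}$ be a sequence of non-negative real numbers and let $g_\Theta(t)=\sum_{m=1}^\infty \frac{\theta_m}{m}t^m$. Suppose that $g_\Theta$ has radius of convergence $1$ and that $g_\Theta$ is continuous in the punctured disc $\{|t|\le 1,\ t\ne 1\}$. Suppose further that there exist an integer $k\ge 1$ and a polynomial $$P(r)=\frac{r^{k+1}}{k+1}+\sum_{j=0}^{k}c_j r^j$$ with real coefficients $c_j$ such that $$g_\Theta(e^{-w})=P(-\log w)+O(w)\qquad\text{for } w\to 0 \text{ with } |\arg(w)|\le \pi/2 .$$ Then for $v>0$, as $n\to\infty$, $$[t^n]\exp\bigl(v g_\Theta(t)\bigr)=\frac{\exp\left(vP(r)+ne^{-r}\right)}{e^{r}\sqrt{2\pi vP''(r)+2\pi ne^{-r}}}\left(1+O\bigl(\log^{-k/2}(n)\bigr)\right),$$ where $r$ is a (real) solution of the equation $vP'(r)=ne^{-r}$. Furthermore, the error term is uniform in $v$ for $v\in[v_1,v_2]$, where $v_1,v_2$ are arbitrary but fixed constants with $1\le v_1<v_2<\infty$.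
   Context: $[t^n]f(t)$ denotes the coefficient of $t^n$ in the power series expansion of $f$ at $0$. "Continuous in the punctured disc" means that $g_\Theta$, defined by its power series for $|t|<1$, extends continuously to $\{|t|\le1,\ t\neq1\}$. $\log w$ is the principal branch, and $\log^{a}(n)=(\log n)^a$. The saddle point equation $vP'(r)=ne^{-r}$ has a solution for all sufficiently large $n$. *)

theory Defs
  imports "HOL-Complex_Analysis.Complex_Analysis"
begin

definition g_fps :: "(nat \<Rightarrow> real) \<Rightarrow> complex fps" where
  "g_fps \<theta> = Abs_fps (\<lambda>m. if m = 0 then 0 else complex_of_real (\<theta> m / real m))"

text \<open>Only meaningful for \<open>norm t < 1\<close>; on the unit circle the theorem uses a continuous
  extension instead.\<close>

definition g_fun :: "(nat \<Rightarrow> real) \<Rightarrow> complex \<Rightarrow> complex" where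
  "g_fun \<theta> t = eval_fps (g_fps \<theta>) t"

definition exp_coeff :: "(nat \<Rightarrow> real) \<Rightarrow> real \<Rightarrow> nat \<Rightarrow> complex" where
  "exp_coeff \<theta> v n = fps_nth (fps_expansion (\<lambda>t. exp (complex_of_real v * g_fun \<theta> t)) 0) n"

definition saddle_point :: "real poly \<Rightarrow> real \<Rightarrow> nat \<Rightarrow> real \<Rightarrow> bool" where
  "saddle_point P v n r \<longleftrightarrow> v * poly (pderiv P) r = real n * exp (- r)"

definition main_term :: "real poly \<Rightarrow> real \<Rightarrow> nat \<Rightarrow> real \<Rightarrow> real" where
  "main_term P v n r =
     exp (v * poly P r + real n * exp (- r)) /
     (exp r * sqrt (2 * pi * v * poly (pderiv (pderiv P)) r + 2 * pi * real n * exp (- r)))"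

end

theory Submission
  imports Defs "HOL-Probability.Sinc_Integral" "HOL-Real_Asymp.Real_Asymp"
begin

text \<open>
  By Cauchy's formula on the circle of radius \<open>exp (- x)\<close> with \<open>x = e\<^sup>-\<^sup>r\<close>, the coefficient is an
  integral of \<open>exp (v g(e\<^sup>-\<^sup>w) + n w)\<close> over a vertical segment through \<open>w = x\<close>, which is a saddle
  point precisely when \<open>v P'(r) = n e\<^sup>-\<^sup>r\<close>. Put \<open>w = x (1 - \<i> s)\<close> and \<open>\<sigma>\<^sup>2 = v (P'(r) + P''(r))\<close>, which is
  of order \<open>r\<^sup>k\<close>. The normalised integrand differs from \<open>exp (- \<sigma>\<^sup>2 s\<^sup>2 / 2)\<close> by at most a constant
  times \<open>1 / (\<sigma> (1 + \<sigma>\<^sup>2 s\<^sup>2))\<close>, uniformly on the whole segment: for small \<open>s\<close> by Taylor expansion,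
  for larger \<open>s\<close> with \<open>w\<close> still near \<open>0\<close> because \<open>P(r) - P(R)\<close> is at least of order \<open>r\<^sup>k (r - R)\<close>
  where \<open>R = - ln \<bar>w\<bar>\<close>, and for \<open>w\<close> away from \<open>0\<close> because \<open>g\<close> is bounded there while
  \<open>exp (- v P(r))\<close> is smaller than every power of \<open>x\<close>. Integration gives the relative error
  \<open>O(1 / \<sigma>) = O(r powr (- k / 2))\<close>, and \<open>r\<close> is comparable to \<open>ln n\<close>.
\<close>

section \<open>Integrals\<close>

lemma has_bochner_integral_inverse_1_plus_square:
  "has_bochner_integral lborel (\<lambda>x::real. inverse (1 + x\<^sup>2)) pi"
proof -
  have eq: "einterval (-\<infinity>) \<infinity> = (UNIV :: real set)"
    by (auto simp: einterval_def)
  have "integrable lborel (\<lambda>x::real. inverse (1 + x\<^sup>2))"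
    using integrable_inverse_1_plus_square by (simp add: eq set_integrable_def)
  moreover have "integral\<^sup>L lborel (\<lambda>x::real. inverse (1 + x\<^sup>2)) = pi"
    using LBINT_inverse_1_plus_square
    by (simp add: interval_lebesgue_integral_def eq set_lebesgue_integral_def)
  ultimately show ?thesis
    by (simp add: has_bochner_integral_iff)
qed

text \<open>The integrand is a constant multiple of the normal density with mean \<open>0\<close>
  and standard deviation \<open>1 / a\<close>.\<close>

lemma has_bochner_integral_gaussian:
  fixes a :: real
  assumes "a > 0"
  shows "has_bochner_integral lborel (\<lambda>t. exp (- (a * t)\<^sup>2 / 2)) (sqrt (2 * pi) / a)"
proof -
  have eq: "exp (- (a * t)\<^sup>2 / 2) = (sqrt (2 * pi) / a) * normal_density 0 (1 / a) t" for t
    using assms by (simp add: normal_density_def real_sqrt_divide real_sqrt_mult power_divide field_simps)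
  have "has_bochner_integral lborel (normal_density 0 (1 / a)) 1"
    using assms by (simp add: has_bochner_integral_iff)
  hence "has_bochner_integral lborel (\<lambda>t. (sqrt (2 * pi) / a) * normal_density 0 (1 / a) t)
      ((sqrt (2 * pi) / a) * 1)"
    by (intro has_bochner_integral_mult_right)
  thus ?thesis unfolding eq by simp
qed

text \<open>The weight \<open>1 / (1 + (a * t)\<^sup>2)\<close> is integrable over the whole line,
  with integral \<open>pi / a\<close>. Once \<open>f\<close> is extended by zero, the two hypotheses
  together say that this weight dominates the difference from the Gaussian everywhere, so one
  integration covers both the segment and the missing tails.\<close>

lemma integral_near_gaussian:
  fixes f :: "real \<Rightarrow> complex"
  assumes a: "a > 0" and cont: "continuous_on {l..u} f"
    and near: "\<And>t. t \<in> {l..u} \<Longrightarrow>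
      norm (f t - complex_of_real (exp (- (a * t)\<^sup>2 / 2))) \<le> E / (1 + (a * t)\<^sup>2)"
    and tail: "\<And>t. t \<notin> {l..u} \<Longrightarrow> exp (- (a * t)\<^sup>2 / 2) \<le> E / (1 + (a * t)\<^sup>2)"
  shows "norm (integral {l..u} f - complex_of_real (sqrt (2 * pi) / a)) \<le> E * pi / a"
proof -
  define g where "g t = complex_of_real (exp (- (a * t)\<^sup>2 / 2))" for t
  define F where "F t = indicator {l..u} t *\<^sub>R f t" for t
  have sF: "set_integrable lborel {l..u} f"
    unfolding set_integrable_def by (rule borel_integrable_compact[OF _ cont]) simp
  have F: "integrable lborel F"
    using sF unfolding set_integrable_def F_def .
  have iF: "(\<integral>t. F t \<partial>lborel) = integral {l..u} f"
    using set_borel_integral_eq_integral(2)[OF sF] unfolding set_lebesgue_integral_def F_def by simp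
  have G: "has_bochner_integral lborel g (complex_of_real (sqrt (2 * pi) / a))"
    unfolding g_def by (intro has_bochner_integral_of_real has_bochner_integral_gaussian a)
  \<comment> \<open>Affine substitution \<open>x = a * t\<close> in the arctangent integral.\<close>
  have "has_bochner_integral lborel (\<lambda>t. inverse (1 + (0 + a * t)\<^sup>2)) (pi /\<^sub>R \<bar>a\<bar>)"
    using a has_bochner_integral_inverse_1_plus_square
    by (subst (asm) lborel_has_bochner_integral_real_affine_iff[where c = a and t = 0]) auto
  hence H: "has_bochner_integral lborel (\<lambda>t. E * inverse (1 + (a * t)\<^sup>2)) (E * (pi / a))"
    using a by (intro has_bochner_integral_mult_right) (simp add: divide_inverse mult.commute)
  have "norm (\<integral>t. F t - g t \<partial>lborel) \<le> (\<integral>t. E * inverse (1 + (a * t)\<^sup>2) \<partial>lborel)"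
  proof (rule Bochner_Integration.integral_norm_bound_integral)
    show "integrable lborel (\<lambda>t. F t - g t)"
      using F G by (auto simp: has_bochner_integral_iff)
    show "integrable lborel (\<lambda>t. E * inverse (1 + (a * t)\<^sup>2))"
      using H by (auto simp: has_bochner_integral_iff)
    show "norm (F t - g t) \<le> E * inverse (1 + (a * t)\<^sup>2)" for t
    proof (cases "t \<in> {l..u}")
      case True
      thus ?thesis using near[OF True] unfolding F_def g_def divide_inverse by simp
    next
      case False
      have "norm (F t - g t) = norm (g t)" using False by (simp add: F_def)
      also have "\<dots> = exp (- (a * t)\<^sup>2 / 2)" unfolding g_def norm_of_real by simp
      finally show ?thesis using tail[OF False] unfolding divide_inverse by simp
    qed
  qed
  also have "(\<integral>t. F t - g t \<partial>lborel) = integral {l..u} f - complex_of_real (sqrt (2 * pi) / a)"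
    using F G by (simp add: has_bochner_integral_iff iF Bochner_Integration.integral_diff)
  also have "(\<integral>t. E * inverse (1 + (a * t)\<^sup>2) \<partial>lborel) = E * pi / a"
    using H by (simp add: has_bochner_integral_iff)
  finally show ?thesis .
qed

section \<open>Cauchy's coefficient formula on a circle\<close>

lemma integral_shift_period:
  fixes h :: "real \<Rightarrow> complex"
  assumes cont: "continuous_on UNIV h" and per: "\<And>t. h (t + 2 * pi) = h t"
  shows "integral {0..2 * pi} h = integral {-pi..pi} h"
proof -
  have int: "h integrable_on {a..b}" for a b
    by (rule integrable_continuous_real) (rule continuous_on_subset[OF cont], simp)
  have "integral {pi..2 * pi} h = integral {pi - 2 * pi..2 * pi - 2 * pi} (\<lambda>t. h (t + 2 * pi))"
    by (rule integral_shift_real_ivl[symmetric])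
  also have "\<dots> = integral {-pi..0} h"
    by (simp add: per)
  finally have 1: "integral {pi..2 * pi} h = integral {-pi..0} h" .
  have "integral {0..2 * pi} h = integral {0..pi} h + integral {pi..2 * pi} h"
    by (intro Henstock_Kurzweil_Integration.integral_combine[symmetric] int) auto
  also have "\<dots> = integral {-pi..0} h + integral {0..pi} h"
    by (simp add: 1)
  also have "\<dots> = integral {-pi..pi} h"
    by (intro Henstock_Kurzweil_Integration.integral_combine int) auto
  finally show ?thesis .
qed

text \<open>This is Cauchy's formula on the circle of radius \<open>exp (- x)\<close>, whose points
  are written as \<open>exp (- w)\<close> with \<open>w = x - \<i> * t\<close>. Periodicity moves
  the range to \<open>{-pi..pi}\<close>, so that the later saddle point \<open>t = 0\<close> sits in
  the middle.\<close>

lemma fps_expansion_nth_eq_integral: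
  assumes hol: "f holomorphic_on ball 0 1" and x: "x > 0"
  shows "fps_nth (fps_expansion f 0) n = 1 / (2 * pi) *
    integral {-pi..pi} (\<lambda>t. f (exp (- (of_real x - \<i> * of_real t))) *
                             exp (of_nat n * (of_real x - \<i> * of_real t)))"
proof -
  define \<rho> where "\<rho> = exp (- x)"
  have \<rho>: "\<rho> > 0" "\<rho> < 1" using x by (auto simp: \<rho>_def)
  define h where "h t = f (exp (- (of_real x - \<i> * of_real t))) *
                             exp (of_nat n * (of_real x - \<i> * of_real t))" for t :: real
  have sub: "cball 0 \<rho> \<subseteq> ball (0::complex) 1" using \<rho> by auto
  have holc: "continuous_on (cball 0 \<rho>) f"
    by (rule holomorphic_on_imp_continuous_on[OF holomorphic_on_subset[OF hol sub]])
  have holb: "f holomorphic_on ball 0 \<rho>"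
    by (rule holomorphic_on_subset[OF hol]) (use \<rho> in auto)
  have eq: "of_real \<rho> * cis t = exp (- (of_real x - \<i> * of_real t))" for t
    by (simp add: \<rho>_def cis_conv_exp exp_of_real exp_diff exp_minus divide_inverse mult.commute)
  have eqn: "inverse ((of_real \<rho> * cis t) ^ n) = exp (of_nat n * (of_real x - \<i> * of_real t))" for t
    unfolding eq exp_of_nat_mult exp_minus by (simp add: power_inverse)
  have conth: "continuous_on UNIV h"
  proof -
    have "continuous_on UNIV (\<lambda>t. f (exp (- (of_real x - \<i> * of_real t))))"
      by (rule continuous_on_compose2[OF holomorphic_on_imp_continuous_on[OF hol]])
         (use x in \<open>auto intro!: continuous_intros\<close>)
    thus ?thesis unfolding h_def by (intro continuous_intros)
  qed
  have h_eq: "h t = f (of_real \<rho> * cis t) / (of_real \<rho> * cis t) ^ n" for t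
    by (simp add: h_def eqn[symmetric] eq divide_inverse)
  have per: "h (t + 2 * pi) = h t" for t
    unfolding h_eq by (simp add: cis_conv_exp algebra_simps exp_add)
  have "fps_nth (fps_expansion f 0) n = (deriv ^^ n) f 0 / fact n"
    by (simp add: fps_expansion_def)
  also have "\<dots> = 1 / (2 * pi * \<i>) * contour_integral (circlepath 0 \<rho>) (\<lambda>u. f u / (u - 0) ^ Suc n)"
    by (subst Cauchy_higher_derivative_integral_circlepath(2)[OF holc holb]) (use \<rho> in auto)
  \<comment> \<open>On the circle \<open>du = \<i> * u * dt\<close>, so one of the
    \<open>Suc n\<close> factors of \<open>u\<close> cancels and \<open>\<i> * h t\<close>
    remains.\<close>
  also have "contour_integral (circlepath 0 \<rho>) (\<lambda>u. f u / (u - 0) ^ Suc n)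
      = integral {0..2 * pi} (\<lambda>t. \<i> * h t)"
    unfolding circlepath_def
    by (subst contour_integral_part_circlepath_eq) (use \<rho> in \<open>auto simp: h_eq field_simps intro!: integral_cong\<close>)
  also have "\<dots> = \<i> * integral {0..2 * pi} h"
    by (rule integral_mult_right)
  also have "integral {0..2 * pi} h = integral {-pi..pi} h"
    by (rule integral_shift_period[OF conth per])
  finally show ?thesis unfolding h_def by simp
qed

section \<open>Complex polynomials and logarithms\<close>

abbreviation (input) cpoly :: "real poly \<Rightarrow> complex \<Rightarrow> complex" where
  "cpoly p \<equiv> poly (map_poly complex_of_real p)"

lemma cpoly_of_real: "cpoly p (of_real x) = of_real (poly p x)"
  by (induction p) (simp_all add: map_poly_pCons)

lemma pderiv_map_poly_of_real:
  "pderiv (map_poly complex_of_real p) = map_poly complex_of_real (pderiv p)"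
  by (rule poly_eqI) (simp add: coeff_pderiv coeff_map_poly)

lemma cpoly_has_field_derivative:
  "(cpoly p has_field_derivative cpoly (pderiv p) z) (at z within S)"
  using DERIV_subset[OF poly_DERIV] unfolding pderiv_map_poly_of_real[symmetric] by blast

text \<open>Outside the unit disc every power up to \<open>m\<close> is dominated by the
  \<open>m\<close>-th. Only an upper bound on the degree is asked for, so higher derivatives,
  possibly zero, are covered without case distinctions.\<close>

lemma norm_poly_le:
  fixes p :: "'a :: real_normed_field poly"
  assumes "degree p \<le> m" "norm z \<ge> 1"
  shows "norm (poly p z) \<le> (\<Sum>i\<le>m. norm (coeff p i)) * norm z ^ m"
proof -
  have "poly p z = (\<Sum>i\<le>m. coeff p i * z ^ i)"
    unfolding poly_altdef using assms(1)
    by (intro sum.mono_neutral_left) (auto simp: coeff_eq_0)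
  also have "norm \<dots> \<le> (\<Sum>i\<le>m. norm (coeff p i) * norm z ^ m)"
    using assms(2)
    by (intro sum_norm_le) (auto simp: norm_mult norm_power intro!: mult_left_mono power_increasing)
  finally show ?thesis by (simp add: sum_distrib_right)
qed

lemma cpoly_bound:
  assumes "degree p \<le> m"
  obtains C where "C \<ge> 0" "\<And>z. norm z \<ge> 1 \<Longrightarrow> norm (cpoly p z) \<le> C * norm z ^ m"
proof
  show "(\<Sum>i\<le>m. norm (coeff (map_poly complex_of_real p) i)) \<ge> 0"
    by (intro sum_nonneg) auto
  show "norm (cpoly p z) \<le> (\<Sum>i\<le>m. norm (coeff (map_poly complex_of_real p) i)) * norm z ^ m"
    if "norm z \<ge> 1" for z
  proof (rule norm_poly_le[OF _ that])
    show "degree (map_poly complex_of_real p) \<le> m"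
      using assms by (intro degree_le) (auto simp: coeff_map_poly coeff_eq_0)
  qed
qed

text \<open>Taylor's theorem of order two: on the disc of radius \<open>1 / 2\<close> one has
  \<open>norm (1 + z) \<ge> 1 / 2\<close>, so the third derivative \<open>2 / (1 + z) ^ 3\<close> is
  at most \<open>16\<close>, and \<open>16 / fact 2 = 8\<close>.\<close>

lemma norm_Ln_taylor2:
  fixes z :: complex
  assumes "norm z \<le> 1 / 2"
  shows "norm (Ln (1 + z) - (z - z\<^sup>2 / 2)) \<le> 8 * norm z ^ 3"
proof -
  define f :: "nat \<Rightarrow> complex \<Rightarrow> complex" where
    "f i = (if i = 0 then (\<lambda>z. Ln (1 + z)) else if i = 1 then (\<lambda>z. inverse (1 + z))
       else if i = 2 then (\<lambda>z. - inverse ((1 + z) ^ 2)) else (\<lambda>z. 2 * inverse ((1 + z) ^ 3)))" for i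
  have ge: "norm (1 + x) \<ge> 1 / 2" and re: "Re (1 + x) > 0" if "x \<in> cball 0 (1 / 2)" for x
  proof -
    have "norm x \<le> 1 / 2" using that by simp
    thus "norm (1 + x) \<ge> 1 / 2" using norm_triangle_ineq2[of 1 "-x"] by simp
    show "Re (1 + x) > 0" using abs_Re_le_cmod[of x] \<open>norm x \<le> 1 / 2\<close> by simp
  qed
  have der0: "((\<lambda>z. Ln (1 + z)) has_field_derivative inverse (1 + x)) (at x within S)"
    if nz: "1 + x \<noteq> 0" "1 + x \<notin> \<real>\<^sub>\<le>\<^sub>0" for x :: complex and S
    using nz by (auto intro!: derivative_eq_intros simp: divide_inverse)
  have der1: "((\<lambda>z. inverse (1 + z)) has_field_derivative - inverse ((1 + x)\<^sup>2)) (at x within S)"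
    if "1 + x \<noteq> 0" for x :: complex and S
    using that by (auto intro!: derivative_eq_intros simp: power2_eq_square)
  have der2: "((\<lambda>z. - inverse ((1 + z)\<^sup>2)) has_field_derivative 2 * inverse ((1 + x) ^ 3)) (at x within S)"
    if nz: "1 + x \<noteq> 0" for x :: complex and S
    using nz
    by (auto intro!: derivative_eq_intros)
       (simp add: divide_simps del: mult_eq_0_iff, simp add: eval_nat_numeral)
  have der: "(f i has_field_derivative f (Suc i) x) (at x within cball 0 (1 / 2))"
    if x: "x \<in> cball 0 (1 / 2)" and i: "i \<le> 2" for i x
  proof -
    have nz1: "1 + x \<notin> \<real>\<^sub>\<le>\<^sub>0" using re[OF x] unfolding complex_nonpos_Reals_iff by linarith
    hence nz: "1 + x \<noteq> 0" by auto
    consider "i = 0" | "i = 1" | "i = 2" using i by linarith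
    thus ?thesis
    proof cases
      case 1
      show ?thesis unfolding 1 f_def using der0[OF nz nz1] by simp
    next
      case 2
      show ?thesis unfolding 2 f_def using der1[OF nz] by simp
    next
      case 3
      show ?thesis unfolding 3 f_def using der2[OF nz] by simp
    qed
  qed
  have bound: "norm (f (Suc 2) x) \<le> 16" if x: "x \<in> cball 0 (1 / 2)" for x
  proof -
    have "(1 / 2) ^ 3 \<le> norm (1 + x) ^ 3" using ge[OF x] by (intro power_mono) auto
    hence "inverse (norm (1 + x) ^ 3) \<le> inverse ((1 / 2) ^ 3)"
      by (intro le_imp_inverse_le) auto
    also have "inverse ((1 / 2) ^ 3) = (8 :: real)" by (simp add: eval_nat_numeral)
    finally have "inverse (norm (1 + x) ^ 3) \<le> 8" .
    moreover have "norm (f (Suc 2) x) = 2 * inverse (norm (1 + x) ^ 3)"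
      by (simp add: f_def norm_mult norm_inverse norm_power)
    ultimately show ?thesis by simp
  qed
  have "norm (f 0 z - (\<Sum>i\<le>2. f i 0 * (z - 0) ^ i / fact i)) \<le> 16 * norm (z - 0) ^ Suc 2 / fact 2"
    by (rule complex_Taylor[of "cball 0 (1 / 2)"]) (use assms der bound in auto)
  thus ?thesis
    by (simp add: f_def eval_nat_numeral algebra_simps)
qed

text \<open>The difference of squares factors into \<open>Ln (1 + z) - z\<close>, which is
  quadratically small, and \<open>Ln (1 + z) + z\<close>, which is linearly small.\<close>

lemma norm_Ln_square_taylor2:
  fixes z :: complex
  assumes "norm z \<le> 1 / 4"
  shows "norm (Ln (1 + z)) \<le> 2 * norm z" "norm ((Ln (1 + z))\<^sup>2 - z\<^sup>2) \<le> 9 * norm z ^ 3"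
proof -
  show L: "norm (Ln (1 + z)) \<le> 2 * norm z"
    using assms by (intro norm_Ln_le) simp
  have "norm (Ln (1 + z) - z) \<le> norm z ^ 2 / (1 - norm z)"
    using assms by (intro Ln_approx_linear) simp
  also have "\<dots> \<le> norm z ^ 2 / (1 / 3)"
    using assms by (intro divide_left_mono) auto
  finally have 1: "norm (Ln (1 + z) - z) \<le> 3 * norm z ^ 2" by simp
  have 2: "norm (Ln (1 + z) + z) \<le> 3 * norm z"
    using norm_triangle_ineq[of "Ln (1 + z)" z] L by simp
  have "(Ln (1 + z))\<^sup>2 - z\<^sup>2 = (Ln (1 + z) - z) * (Ln (1 + z) + z)"
    by (simp add: power2_eq_square algebra_simps)
  also have "norm \<dots> \<le> (3 * norm z ^ 2) * (3 * norm z)"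
    unfolding norm_mult by (intro mult_mono 1 2) auto
  finally show "norm ((Ln (1 + z))\<^sup>2 - z\<^sup>2) \<le> 9 * norm z ^ 3"
    by (simp add: eval_nat_numeral)
qed

text \<open>Used in two ways: with \<open>c * r ^ k\<close> an upper bound for the squared width
  \<sigma> of the saddle, it makes any loss of a factor \<sigma> negligible against
  \<open>exp r\<close>; it also compares a saddle point \<open>r\<close> with
  \<open>ln n\<close>.\<close>

lemma power_le_exp_half:
  fixes c :: real and k :: nat
  shows "\<forall>\<^sub>F r in at_top. 1 + c * r ^ k \<le> exp (r / 2)"
proof -
  have "((\<lambda>r::real. 2 ^ k * ((r / 2) ^ k / exp (r / 2))) \<longlongrightarrow> 2 ^ k * 0) at_top"
    by (intro tendsto_mult tendsto_const filterlim_compose[OF tendsto_power_div_exp_0])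
       real_asymp
  hence 1: "((\<lambda>r. c * (r ^ k / exp (r / 2))) \<longlongrightarrow> c * 0) at_top"
    by (intro tendsto_mult tendsto_const) (simp add: power_divide)
  have 2: "((\<lambda>r::real. 1 / exp (r / 2)) \<longlongrightarrow> 0) at_top" by real_asymp
  have "((\<lambda>r::real. 1 / exp (r / 2) + c * (r ^ k / exp (r / 2))) \<longlongrightarrow> 0 + c * 0) at_top"
    by (intro tendsto_add 1 2)
  hence "((\<lambda>r. (1 + c * r ^ k) / exp (r / 2)) \<longlongrightarrow> 0) at_top"
    by (simp add: add_divide_distrib)
  hence "\<forall>\<^sub>F r in at_top. (1 + c * r ^ k) / exp (r / 2) < 1"
    by (rule order_tendstoD) simp
  thus ?thesis by eventually_elim (simp add: field_simps)
qed

section \<open>Growth and Taylor estimates for the polynomial \<open>P\<close>\<close>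

locale log_poly =
  fixes P :: "real poly" and k :: nat
  assumes k: "k \<ge> 1" and deg: "degree P = Suc k" and lc: "lead_coeff P = 1 / real (Suc k)"
begin

text \<open>The prescribed leading coefficient of \<open>P\<close> makes \<open>pderiv P\<close>
  monic of degree \<open>k\<close>.\<close>

lemma deriv_asymp: "((\<lambda>r. poly (pderiv P) r / r ^ k) \<longlongrightarrow> 1) at_top"
proof -
  have "lead_coeff (pderiv P) = 1"
    using deg lc by (simp add: degree_pderiv coeff_pderiv)
  moreover have "degree (pderiv P) = k" using deg by (simp add: degree_pderiv)
  ultimately show ?thesis
    using poly_divide_tendsto_aux[of "pderiv P"] filterlim_mono[OF _ order_refl at_top_le_at_infinity] by metis
qed

lemma deriv_bounds:
  "\<forall>\<^sub>F r in at_top. r ^ k / 2 \<le> poly (pderiv P) r \<and> poly (pderiv P) r \<le> 2 * r ^ k"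
proof -
  have "\<forall>\<^sub>F r in at_top. 1 / 2 < poly (pderiv P) r / r ^ k"
    by (rule order_tendstoD(1)[OF deriv_asymp]) simp
  moreover have "\<forall>\<^sub>F r in at_top. poly (pderiv P) r / r ^ k < 2"
    by (rule order_tendstoD(2)[OF deriv_asymp]) simp
  ultimately show ?thesis
    using eventually_gt_at_top[of 0] by eventually_elim (auto simp: field_simps)
qed

lemma deriv2_nonneg: "\<forall>\<^sub>F r in at_top. poly (pderiv (pderiv P)) r \<ge> 0"
proof -
  \<comment> \<open>The leading coefficient is \<open>k\<close>, positive because
    \<open>k \<ge> 1\<close>.\<close>
  have "lead_coeff (pderiv (pderiv P)) > 0"
    using deg lc k by (simp add: degree_pderiv coeff_pderiv)
  from poly_pinfty_gt_lc[OF this] this obtain n where "\<forall>x\<ge>n. poly (pderiv (pderiv P)) x \<ge> 0"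
    by (metis less_imp_le order_trans)
  thus ?thesis unfolding eventually_at_top_linorder by blast
qed

lemma deriv2_le:
  obtains C where "C \<ge> 0" "\<And>r. r \<ge> 1 \<Longrightarrow> \<bar>poly (pderiv (pderiv P)) r\<bar> \<le> C * r ^ k"
proof
  show "(\<Sum>i\<le>k. norm (coeff (pderiv (pderiv P)) i)) \<ge> 0" by (intro sum_nonneg) auto
  show "\<bar>poly (pderiv (pderiv P)) r\<bar> \<le> (\<Sum>i\<le>k. norm (coeff (pderiv (pderiv P)) i)) * r ^ k"
    if "r \<ge> 1" for r
    using norm_poly_le[of "pderiv (pderiv P)" k r] that deg by (simp add: degree_pderiv)
qed

text \<open>Eventually \<open>P' \<ge> t ^ k / 2\<close>, so \<open>P\<close> minus half of its
  leading monomial is nondecreasing; and \<open>r ^ Suc k - R ^ Suc k \<ge> r ^ k * (r - R)\<close>.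
  This measures how much the integrand loses when \<open>\<bar>w\<bar>\<close> grows from
  \<open>exp (- r)\<close> to \<open>exp (- R)\<close>.\<close>

lemma increment_lower_bound:
  obtains R0 where "R0 \<ge> 1"
    "\<And>R r. R0 \<le> R \<Longrightarrow> R \<le> r \<Longrightarrow> r ^ k * (r - R) / (2 * real (Suc k)) \<le> poly P r - poly P R"
proof -
  from deriv_bounds obtain R1 where R1: "\<And>r. r \<ge> R1 \<Longrightarrow> r ^ k / 2 \<le> poly (pderiv P) r"
    unfolding eventually_at_top_linorder by blast
  show ?thesis
  proof (rule that[of "max 1 R1"])
    fix R r :: real assume R: "max 1 R1 \<le> R" "R \<le> r"
    let ?h = "\<lambda>t. poly P t - t ^ Suc k / (2 * real (Suc k))"
    have "?h R \<le> ?h r"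
    proof (rule DERIV_nonneg_imp_nondecreasing[OF R(2)])
      fix t assume t: "R \<le> t" "t \<le> r"
      have "((\<lambda>t. t ^ Suc k) has_real_derivative real (Suc k) * t ^ k) (at t)"
        using DERIV_pow[of "Suc k" t] by simp
      from DERIV_diff[OF poly_DERIV[of P t] DERIV_cdivide[OF this, of "2 * real (Suc k)"]]
      have "(?h has_real_derivative poly (pderiv P) t - t ^ k / 2) (at t)"
        by (simp del: power_Suc of_nat_Suc)
      moreover have "poly (pderiv P) t - t ^ k / 2 \<ge> 0" using R1[of t] t R by simp
      ultimately show "\<exists>y. DERIV ?h t :> y \<and> 0 \<le> y" by blast
    qed
    moreover have "r ^ k * (r - R) \<le> r ^ Suc k - R ^ Suc k"
      using power_mono[of R r k] R by (simp add: algebra_simps mult_left_mono)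
    hence "r ^ k * (r - R) / (2 * real (Suc k)) \<le> (r ^ Suc k - R ^ Suc k) / (2 * real (Suc k))"
      by (rule divide_right_mono) simp
    ultimately show "r ^ k * (r - R) / (2 * real (Suc k)) \<le> poly P r - poly P R"
      by (simp add: diff_divide_distrib)
  qed simp
qed

text \<open>In the first-order Taylor expansion at \<open>R\<close> the linear term
  \<open>\<i> * \<phi> * P'(R)\<close> is purely imaginary, so the real part changes only by the
  remainder, which \<open>P''\<close> controls. The resulting order \<open>R ^ (k - 1)\<close> is
  one below the decay that it must not spoil. The bound \<open>2\<close> on
  \<open>\<bar>\<phi>\<bar>\<close> covers all arguments up to \<open>pi / 2\<close>.\<close>

lemma Re_cpoly_vertical_le:
  obtains C where "C \<ge> 0" "\<And>R \<phi>. R \<ge> 1 \<Longrightarrow> \<bar>\<phi>\<bar> \<le> 2 \<Longrightarrow>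
    Re (cpoly P (of_real R + \<i> * of_real \<phi>)) \<le> poly P R + C * R ^ (k - 1)"
proof -
  have "degree (pderiv (pderiv P)) \<le> k - 1" using deg by (simp add: degree_pderiv)
  from cpoly_bound[OF this] obtain C where C: "C \<ge> 0"
    "\<And>z. norm z \<ge> 1 \<Longrightarrow> norm (cpoly (pderiv (pderiv P)) z) \<le> C * norm z ^ (k - 1)" by blast
  show ?thesis
  \<comment> \<open>On the segment \<open>norm z \<le> R + 2 \<le> 3 * R\<close>, and
    \<open>\<phi>\<^sup>2 \<le> 4\<close>.\<close>
  proof (rule that[of "C * 3 ^ (k - 1) * 4"])
    fix R \<phi> :: real assume R: "R \<ge> 1" and \<phi>: "\<bar>\<phi>\<bar> \<le> 2"
    define S where "S = closed_segment (of_real R) (of_real R + \<i> * of_real \<phi>)"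
    define f where "f i = cpoly ((pderiv ^^ i) P)" for i
    have B: "norm (f (Suc 1) z) \<le> C * 3 ^ (k - 1) * R ^ (k - 1)" if "z \<in> S" for z
    proof -
      from that obtain u where u: "0 \<le> u" "u \<le> 1" "z = of_real R + \<i> * of_real (u * \<phi>)"
        unfolding S_def in_segment by (auto simp: algebra_simps scaleR_conv_of_real)
      have "R \<le> norm z" using complex_Re_le_cmod[of z] by (simp add: u)
      moreover have "norm z \<le> R + \<bar>u * \<phi>\<bar>"
        unfolding u(3) using norm_triangle_ineq[of "of_real R" "\<i> * of_real (u * \<phi>)"] R
        by (simp add: norm_mult)
      hence "norm z \<le> 3 * R" using u R \<phi> mult_mono[of u 1 "\<bar>\<phi>\<bar>" 2] by (simp add: abs_mult)
      ultimately have "norm (f (Suc 1) z) \<le> C * norm z ^ (k - 1)"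
        using C(2)[of z] R by (simp add: f_def)
      also have "\<dots> \<le> C * (3 * R) ^ (k - 1)"
        using \<open>norm z \<le> 3 * R\<close> C(1) by (intro mult_left_mono power_mono) auto
      finally show ?thesis by (simp add: power_mult_distrib mult.assoc)
    qed
    have der: "(f i has_field_derivative f (Suc i) x) (at x within S)" for i x
      unfolding f_def by (simp add: cpoly_has_field_derivative)
    let ?z = "of_real R + \<i> * of_real \<phi> :: complex"
    have "norm (f 0 ?z - (\<Sum>i\<le>1. f i (of_real R) * (?z - of_real R) ^ i / fact i))
        \<le> (C * 3 ^ (k - 1) * R ^ (k - 1)) * norm (?z - of_real R) ^ Suc 1 / fact 1"
      by (rule complex_Taylor[OF _ der B]) (auto simp: S_def)
    hence "norm (cpoly P ?z - (of_real (poly P R) + of_real (poly (pderiv P) R) * (\<i> * of_real \<phi>)))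
        \<le> (C * 3 ^ (k - 1) * R ^ (k - 1)) * \<phi>\<^sup>2"
      by (simp add: f_def cpoly_of_real norm_mult power2_eq_square)
    also have "\<dots> \<le> (C * 3 ^ (k - 1) * R ^ (k - 1)) * 4"
      using C(1) R \<phi> abs_le_square_iff[of \<phi> 2] by (intro mult_left_mono) auto
    finally have "\<bar>Re (cpoly P ?z) - poly P R\<bar> \<le> (C * 3 ^ (k - 1) * R ^ (k - 1)) * 4"
      by (rule order_trans[rotated]) (rule order_trans[OF _ abs_Re_le_cmod], simp)
    thus "Re (cpoly P ?z) \<le> poly P R + C * 3 ^ (k - 1) * 4 * R ^ (k - 1)"
      by (simp add: algebra_simps)
  qed (use C in auto)
qed

text \<open>For \<open>r \<ge> 2\<close> the unit disc about \<open>r\<close> consists of points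
  with norm between \<open>1\<close> and \<open>2 * r\<close>, where the third derivative is at most
  a constant times \<open>r ^ k\<close>.\<close>

lemma cpoly_taylor2:
  obtains C where "C \<ge> 0" "\<And>r h. r \<ge> 2 \<Longrightarrow> norm h \<le> 1 \<Longrightarrow>
    norm (cpoly P (of_real r + h) - (of_real (poly P r) + of_real (poly (pderiv P) r) * h
            + of_real (poly (pderiv (pderiv P)) r) * h\<^sup>2 / 2)) \<le> C * r ^ k * norm h ^ 3"
proof -
  have "degree (pderiv (pderiv (pderiv P))) \<le> k" using deg by (simp add: degree_pderiv)
  from cpoly_bound[OF this] obtain C where C: "C \<ge> 0"
    "\<And>z. norm z \<ge> 1 \<Longrightarrow> norm (cpoly (pderiv (pderiv (pderiv P))) z) \<le> C * norm z ^ k" by blast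
  show ?thesis
  proof (rule that[of "C * 2 ^ k"])
    fix r :: real and h :: complex assume r: "r \<ge> 2" and h: "norm h \<le> 1"
    define S where "S = cball (complex_of_real r) 1"
    define f where "f i = cpoly ((pderiv ^^ i) P)" for i
    have B: "norm (f (Suc 2) z) \<le> C * 2 ^ k * r ^ k" if "z \<in> S" for z
    proof -
      have d: "norm (z - of_real r) \<le> 1" using that by (simp add: S_def dist_norm norm_minus_commute)
      have "norm z \<ge> 1" "norm z \<le> 2 * r"
        using norm_triangle_ineq2[of "of_real r" "of_real r - z"]
              norm_triangle_ineq[of "of_real r" "z - of_real r"] d r by (auto simp: norm_minus_commute)
      hence "norm (f (Suc 2) z) \<le> C * norm z ^ k"
        using C(2)[of z] by (simp add: f_def eval_nat_numeral)
      also have "\<dots> \<le> C * (2 * r) ^ k"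
        using \<open>norm z \<le> 2 * r\<close> C(1) by (intro mult_left_mono power_mono) auto
      finally show ?thesis by (simp add: power_mult_distrib mult.assoc)
    qed
    have der: "(f i has_field_derivative f (Suc i) x) (at x within S)" for i x
      unfolding f_def by (simp add: cpoly_has_field_derivative)
    let ?z = "of_real r + h :: complex"
    have "norm (f 0 ?z - (\<Sum>i\<le>2. f i (of_real r) * (?z - of_real r) ^ i / fact i))
        \<le> (C * 2 ^ k * r ^ k) * norm (?z - of_real r) ^ Suc 2 / fact 2"
      by (rule complex_Taylor[OF _ der B]) (use h in \<open>auto simp: S_def dist_norm\<close>)
    also have "\<dots> \<le> (C * 2 ^ k * r ^ k) * norm h ^ 3"
      using C(1) r by (simp add: eval_nat_numeral)
    finally show "norm (cpoly P (of_real r + h) - (of_real (poly P r) + of_real (poly (pderiv P) r) * h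
            + of_real (poly (pderiv (pderiv P)) r) * h\<^sup>2 / 2)) \<le> C * 2 ^ k * r ^ k * norm h ^ 3"
      by (simp add: f_def cpoly_of_real eval_nat_numeral add.assoc)
  qed (use C in auto)
qed

text \<open>Substitute \<open>h = - Ln (1 + z)\<close>, which is \<open>- z + z\<^sup>2 / 2\<close>
  up to a cubic error, into the Taylor expansion of \<open>P\<close>. The quadratic part of the
  logarithm adds \<open>P'\<close> to the second-order coefficient \<open>P''\<close>; this is the
  origin of \<open>P' + P''\<close> in \<sigma>.\<close>

lemma saddle_exponent_taylor:
  obtains C where "C \<ge> 0" "\<forall>\<^sub>F r in at_top. \<forall>z. norm z \<le> 1 / 4 \<longrightarrow>
    norm (cpoly P (of_real r - Ln (1 + z)) - of_real (poly P r) + of_real (poly (pderiv P) r) * z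
          - of_real (poly (pderiv P) r + poly (pderiv (pderiv P)) r) * z\<^sup>2 / 2)
      \<le> C * r ^ k * norm z ^ 3"
proof -
  from cpoly_taylor2 obtain C1 where C1: "C1 \<ge> 0" "\<And>r h. r \<ge> 2 \<Longrightarrow> norm h \<le> 1 \<Longrightarrow>
    norm (cpoly P (of_real r + h) - (of_real (poly P r) + of_real (poly (pderiv P) r) * h
            + of_real (poly (pderiv (pderiv P)) r) * h\<^sup>2 / 2)) \<le> C1 * r ^ k * norm h ^ 3"
    by blast
  from deriv2_le obtain C2 where C2: "C2 \<ge> 0"
    "\<And>r. r \<ge> 1 \<Longrightarrow> \<bar>poly (pderiv (pderiv P)) r\<bar> \<le> C2 * r ^ k" by blast
  show ?thesis
  \<comment> \<open>\<open>8 * C1\<close> is the remainder of \<open>P\<close> with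
    \<open>norm L \<le> 2 * norm z\<close>, \<open>16\<close> comes from
    \<open>P' \<le> 2 * r ^ k\<close> times the error \<open>8\<close> of the logarithm, and
    \<open>9 * C2\<close> from replacing \<open>L\<^sup>2\<close> by
    \<open>z\<^sup>2\<close>.\<close>
  proof (rule that[of "8 * C1 + 16 + 9 * C2"])
    show "\<forall>\<^sub>F r in at_top. \<forall>z. norm z \<le> 1 / 4 \<longrightarrow>
      norm (cpoly P (of_real r - Ln (1 + z)) - of_real (poly P r) + of_real (poly (pderiv P) r) * z
          - of_real (poly (pderiv P) r + poly (pderiv (pderiv P)) r) * z\<^sup>2 / 2)
        \<le> (8 * C1 + 16 + 9 * C2) * r ^ k * norm z ^ 3"
      using deriv_bounds eventually_ge_at_top[of 2]
    proof eventually_elim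
      case (elim r)
      show ?case
      proof (intro allI impI)
        fix z :: complex assume z: "norm z \<le> 1 / 4"
        define L where "L = Ln (1 + z)"
        define p1 where "p1 = poly (pderiv P) r"
        define p2 where "p2 = poly (pderiv (pderiv P)) r"
        have L: "norm L \<le> 2 * norm z" "norm (L\<^sup>2 - z\<^sup>2) \<le> 9 * norm z ^ 3"
          unfolding L_def using norm_Ln_square_taylor2[OF z] by blast+
        have L3: "norm (L - (z - z\<^sup>2 / 2)) \<le> 8 * norm z ^ 3"
          unfolding L_def using z by (intro norm_Ln_taylor2) simp
        define E where "E = cpoly P (of_real r - L) - (of_real (poly P r) - of_real p1 * L
            + of_real p2 * L\<^sup>2 / 2)"
        have rk: "r ^ k \<ge> 0" using elim by simp
        have "norm E \<le> C1 * r ^ k * norm (-L) ^ 3"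
          using C1(2)[of r "-L"] L(1) z elim by (simp add: E_def p1_def p2_def)
        also have "\<dots> \<le> C1 * r ^ k * (2 * norm z) ^ 3"
          using L(1) C1(1) rk by (intro mult_left_mono power_mono) auto
        finally have nE: "norm E \<le> 8 * C1 * r ^ k * norm z ^ 3"
          by (simp add: power_mult_distrib)
        have n1: "norm (of_real p1 * (L - (z - z\<^sup>2 / 2))) \<le> (2 * r ^ k) * (8 * norm z ^ 3)"
          unfolding norm_mult using elim rk by (intro mult_mono L3) (auto simp: p1_def)
        have n2: "norm (of_real (p2 / 2) * (L\<^sup>2 - z\<^sup>2)) \<le> (C2 * r ^ k) * (9 * norm z ^ 3)"
          unfolding norm_mult using C2(2)[of r] elim rk C2(1)
          by (intro mult_mono L(2)) (auto simp: p2_def)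
        have "cpoly P (of_real r - L) - of_real (poly P r) + of_real p1 * z
              - of_real (p1 + p2) * z\<^sup>2 / 2
            = E - of_real p1 * (L - (z - z\<^sup>2 / 2)) + of_real (p2 / 2) * (L\<^sup>2 - z\<^sup>2)"
          by (simp add: E_def field_simps)
        also have "norm \<dots> \<le> norm E + norm (of_real p1 * (L - (z - z\<^sup>2 / 2)))
            + norm (of_real (p2 / 2) * (L\<^sup>2 - z\<^sup>2))"
          by (intro order_trans[OF norm_triangle_ineq] add_mono norm_triangle_ineq4 order_refl)
        also have "\<dots> \<le> (8 * C1 + 16 + 9 * C2) * r ^ k * norm z ^ 3"
          using nE n1 n2 by (simp add: algebra_simps)
        finally show "norm (cpoly P (of_real r - Ln (1 + z)) - of_real (poly P r)
            + of_real (poly (pderiv P) r) * z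
            - of_real (poly (pderiv P) r + poly (pderiv (pderiv P)) r) * z\<^sup>2 / 2)
          \<le> (8 * C1 + 16 + 9 * C2) * r ^ k * norm z ^ 3"
          unfolding p1_def p2_def L_def .
      qed
    qed
  qed (use C1 C2 in auto)
qed

section \<open>Existence and size of the saddle points\<close>

lemma saddle_point_iff:
  "saddle_point P v n r \<longleftrightarrow> v * (poly (pderiv P) r * exp r) = real n"
proof -
  have "saddle_point P v n r \<longleftrightarrow> v * poly (pderiv P) r * exp r = real n * exp (- r) * exp r"
    unfolding saddle_point_def by simp
  also have "real n * exp (- r) * exp r = real n"
    by (simp add: exp_minus)
  finally show ?thesis by (simp add: mult.assoc)
qed

text \<open>As \<open>r\<close> tends to minus infinity the exponential beats the polynomial, and
  the remaining interval is compact. Hence for large \<open>n\<close> the equation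
  \<open>v * P'(r) * exp r = n\<close> has no solution to the left of a fixed
  \<open>R\<close>.\<close>

lemma deriv_times_exp_bounded:
  obtains B where "B > 0" "\<And>r. r \<le> R \<Longrightarrow> poly (pderiv P) r * exp r \<le> B"
proof -
  define c where "c = (\<Sum>i\<le>k. norm (coeff (pderiv P) i))"
  have "((\<lambda>x::real. x ^ k / exp x) \<longlongrightarrow> 0) at_top" by (rule tendsto_power_div_exp_0)
  hence "\<forall>\<^sub>F x::real in at_top. x ^ k / exp x < 1" by (rule order_tendstoD) simp
  then obtain X where X: "\<And>x::real. x \<ge> X \<Longrightarrow> x ^ k / exp x < 1"
    unfolding eventually_at_top_linorder by blast
  define Y where "Y = max 1 X"
  have "compact ((\<lambda>r. poly (pderiv P) r * exp r) ` {-Y..R})"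
    by (intro compact_continuous_image continuous_intros) auto
  hence "bounded ((\<lambda>r. poly (pderiv P) r * exp r) ` {-Y..R})" by (rule compact_imp_bounded)
  then obtain B where B: "B > 0" "\<And>r. r \<in> {-Y..R} \<Longrightarrow> norm (poly (pderiv P) r * exp r) \<le> B"
    unfolding bounded_pos by auto
  have c0: "c \<ge> 0" unfolding c_def by (intro sum_nonneg) auto
  show ?thesis
  proof (rule that[of "B + c"])
    fix r assume r: "r \<le> R"
    show "poly (pderiv P) r * exp r \<le> B + c"
    proof (cases "r \<ge> - Y")
      case True
      thus ?thesis using B(2)[of r] r c0 by auto
    next
      case False
      hence r1: "norm r \<ge> 1" "- r \<ge> X" and r0: "r \<le> 0" by (auto simp: Y_def)
      have "norm (poly (pderiv P) r) \<le> c * norm r ^ k"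
        unfolding c_def using deg r1 by (intro norm_poly_le) (auto simp: degree_pderiv)
      hence "poly (pderiv P) r \<le> c * (- r) ^ k" using r0 by simp
      hence "poly (pderiv P) r * exp r \<le> c * (- r) ^ k * exp r" by (intro mult_right_mono) auto
      also have "\<dots> = c * ((- r) ^ k / exp (- r))" by (simp add: exp_minus divide_inverse)
      also have "\<dots> \<le> c * 1" using X[OF r1(2)] c0 by (intro mult_left_mono) auto
      finally show ?thesis using B(1) by simp
    qed
  qed (use B c0 in simp)
qed

text \<open>Existence follows from the intermediate value theorem. The size bounds are proved for
  every solution, since the asymptotics are claimed for each of them: a solution cannot lie where
  \<open>P'(r) * exp r\<close> is bounded, and to the right of that
  \<open>n \<le> 2 * v2 * r ^ k * exp r \<le> exp (2 * r)\<close>.\<close>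

lemma saddle_points_large:
  assumes v: "0 < v1" "v1 \<le> v2"
  shows "\<exists>N. \<forall>n\<ge>N. \<forall>v\<in>{v1..v2}. (\<exists>r. saddle_point P v n r) \<and>
    (\<forall>r. saddle_point P v n r \<longrightarrow> r \<ge> R \<and> ln (real n) \<le> 2 * r)"
proof -
  from eventually_conj[OF deriv_bounds eventually_conj[OF power_le_exp_half[of "2 * v2" k]
         eventually_ge_at_top[of "max 1 R"]]]
  obtain R' where R': "\<And>r. r \<ge> R' \<Longrightarrow> r ^ k / 2 \<le> poly (pderiv P) r \<and>
      poly (pderiv P) r \<le> 2 * r ^ k \<and> 1 + 2 * v2 * r ^ k \<le> exp (r / 2) \<and> max 1 R \<le> r"
    unfolding eventually_at_top_linorder by blast
  obtain B where B: "B > 0" "\<And>r. r \<le> R' \<Longrightarrow> poly (pderiv P) r * exp r \<le> B"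
    using deriv_times_exp_bounded by blast
  show ?thesis
  proof (intro exI allI impI ballI)
    fix n v assume n: "n \<ge> nat \<lceil>v2 * B\<rceil> + 1" and vv: "v \<in> {v1..v2}"
    have nB: "real n > v2 * B" using n by linarith
    hence n0: "real n > 0" using v B(1) by (metis less_trans mult_pos_pos order_less_le_trans)
    have small: "v * (poly (pderiv P) r * exp r) < real n" if "r \<le> R'" for r
    proof -
      have "v * (poly (pderiv P) r * exp r) \<le> v * B" using B(2)[OF that] vv v by (intro mult_left_mono) auto
      also have "\<dots> \<le> v2 * B" using vv B(1) by (intro mult_right_mono) auto
      finally show ?thesis using nB by simp
    qed
    have "\<exists>r. saddle_point P v n r"
    proof -
      \<comment> \<open>At \<open>M\<close> one has \<open>P' \<ge> 1 / 2\<close> and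
        \<open>exp M \<ge> 2 * n / v1\<close>, so \<open>v * P'(M) * exp M\<close> is at least
        \<open>n\<close>.\<close>
      define M where "M = max R' (ln (2 * real n / v1))"
      have "real n \<le> v * (poly (pderiv P) M * exp M)"
      proof -
        have M: "M \<ge> R'" "M \<ge> 1" using R'[of M] by (auto simp: M_def)
        have "1 / 2 \<le> M ^ k / 2" using M by (simp add: one_le_power)
        also have "\<dots> \<le> poly (pderiv P) M" using R' M by blast
        finally have 1: "1 / 2 \<le> poly (pderiv P) M" .
        have "2 * real n / v1 = exp (ln (2 * real n / v1))" using n0 v by simp
        also have "\<dots> \<le> exp M" by (simp add: M_def)
        finally have 2: "2 * real n / v1 \<le> exp M" .
        have "real n = v1 * (1 / 2 * (2 * real n / v1))" using v by simp
        also have "\<dots> \<le> v * (poly (pderiv P) M * exp M)"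
          using 1 2 v vv n0 by (intro mult_mono) auto
        finally show ?thesis .
      qed
      moreover have "R' \<le> M" by (simp add: M_def)
      ultimately have "\<exists>r\<ge>R'. r \<le> M \<and> v * (poly (pderiv P) r * exp r) = real n"
        using small[of R'] by (intro IVT') (auto intro!: continuous_intros)
      thus ?thesis unfolding saddle_point_iff by blast
    qed
    moreover have "r \<ge> R \<and> ln (real n) \<le> 2 * r" if "saddle_point P v n r" for r
    proof -
      have eq: "v * (poly (pderiv P) r * exp r) = real n" using that by (simp add: saddle_point_iff)
      hence "r \<ge> R'" using small[of r] by linarith
      from R'[OF this] have r: "poly (pderiv P) r \<le> 2 * r ^ k" "1 + 2 * v2 * r ^ k \<le> exp (r / 2)" "r \<ge> 1" "r \<ge> R"
        by auto
      have "real n \<le> v2 * (2 * r ^ k * exp r)"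
        unfolding eq[symmetric] using v vv r R'[OF \<open>r \<ge> R'\<close>]
        by (intro mult_mono mult_right_mono) (auto intro!: mult_nonneg_nonneg order_trans[of 0 "r ^ k / 2"])
      also have "\<dots> = (2 * v2 * r ^ k) * exp r" by simp
      also have "\<dots> \<le> exp r * exp r"
      proof (rule mult_right_mono)
        have "2 * v2 * r ^ k \<le> exp (r / 2)" using r by simp
        also have "\<dots> \<le> exp r" using r by simp
        finally show "2 * v2 * r ^ k \<le> exp r" .
      qed simp
      also have "\<dots> = exp (2 * r)" by (simp add: exp_add[symmetric])
      finally have "ln (real n) \<le> ln (exp (2 * r))" using n0 by (intro ln_mono) auto
      thus ?thesis using r by simp
    qed
    ultimately show "(\<exists>r. saddle_point P v n r) \<and>
        (\<forall>r. saddle_point P v n r \<longrightarrow> r \<ge> R \<and> ln (real n) \<le> 2 * r)" by blast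
  qed
qed

end

section \<open>The integrand near and away from the saddle point\<close>

text \<open>With \<open>t = 1 + y\<^sup>2 / 8\<close> the cubic factor is at most
  \<open>(8 * D + 1) * t\<^sup>2\<close> and the quadratic one at most \<open>8 * t\<close>, while
  \<open>t \<le> exp (y\<^sup>2 / 8)\<close>. The exponent \<open>3 / 8\<close> is what remains of
  the Gaussian \<open>1 / 2\<close> after a loss of \<open>1 / 8\<close>.\<close>

lemma cubic_times_quadratic_le_exp:
  fixes y D :: real
  assumes "D \<ge> 0"
  shows "(D * \<bar>y\<bar> ^ 3 + 1) * (1 + y\<^sup>2) \<le> 8 * (8 * D + 1) * exp (3 * y\<^sup>2 / 8)"
proof -
  define t where "t = 1 + y\<^sup>2 / 8"
  have t: "t \<ge> 1" by (simp add: t_def)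
  have "\<bar>y\<bar> ^ 3 \<le> 8 * t\<^sup>2"
  proof -
    have "0 \<le> (\<bar>y\<bar>\<^sup>2 / 8 - \<bar>y\<bar> / 2)\<^sup>2 * 8" by simp
    also have "\<dots> = 8 * t\<^sup>2 - \<bar>y\<bar> ^ 3 - 8"
      by (simp add: t_def power2_eq_square power3_eq_cube field_simps)
    finally show ?thesis by simp
  qed
  hence "D * \<bar>y\<bar> ^ 3 + 1 \<le> D * (8 * t\<^sup>2) + t\<^sup>2"
    using assms t by (intro add_mono mult_left_mono) auto
  moreover have "1 + y\<^sup>2 \<le> 8 * t" by (simp add: t_def)
  ultimately have "(D * \<bar>y\<bar> ^ 3 + 1) * (1 + y\<^sup>2) \<le> (D * (8 * t\<^sup>2) + t\<^sup>2) * (8 * t)"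
    using assms t by (intro mult_mono) auto
  also have "\<dots> = 8 * (8 * D + 1) * t ^ 3"
    by (simp add: power2_eq_square power3_eq_cube algebra_simps)
  also have "t ^ 3 \<le> exp (y\<^sup>2 / 8) ^ 3"
    using t exp_ge_add_one_self[of "y\<^sup>2 / 8"] unfolding t_def by (intro power_mono) auto
  also have "exp (y\<^sup>2 / 8) ^ 3 = exp (3 * y\<^sup>2 / 8)"
    by (simp add: exp_of_nat_mult[symmetric])
  finally show ?thesis using assms by simp
qed

text \<open>Write \<open>exp (y\<^sup>2 / 2)\<close> as a product of two copies of
  \<open>exp (y\<^sup>2 / 4)\<close>: one dominates \<open>\<bar>y\<bar>\<close>, hence
  \<open>\<sigma> * u\<close>, and the other dominates \<open>(1 + y\<^sup>2) / 4\<close>. Away from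
  the centre the Gaussian itself thus has the size of the admissible error.\<close>

lemma gaussian_tail_le:
  fixes \<sigma> u y :: real
  assumes "\<sigma> > 0" "u > 0" "\<bar>y\<bar> \<ge> \<sigma> * u"
  shows "exp (- y\<^sup>2 / 2) \<le> 4 / u / \<sigma> / (1 + y\<^sup>2)"
proof -
  have e: "1 + y\<^sup>2 / 4 \<le> exp (y\<^sup>2 / 4)" by (rule exp_ge_add_one_self)
  have "0 \<le> (1 - \<bar>y\<bar> / 2)\<^sup>2" by simp
  hence "\<bar>y\<bar> \<le> 1 + y\<^sup>2 / 4" by (simp add: power2_eq_square algebra_simps)
  hence "\<sigma> * u \<le> exp (y\<^sup>2 / 4)" using assms(3) e by linarith
  moreover have "(1 + y\<^sup>2) / 4 \<le> exp (y\<^sup>2 / 4)" using e by (simp add: field_simps)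
  ultimately have "(\<sigma> * u) * ((1 + y\<^sup>2) / 4) \<le> exp (y\<^sup>2 / 4) * exp (y\<^sup>2 / 4)"
    using assms by (intro mult_mono) auto
  also have "\<dots> = exp (y\<^sup>2 / 2)" by (simp add: exp_add[symmetric])
  finally have "exp (- (y\<^sup>2 / 2)) \<le> inverse ((\<sigma> * u) * ((1 + y\<^sup>2) / 4))"
    unfolding exp_minus using assms by (intro le_imp_inverse_le) (auto intro!: mult_pos_pos add_pos_nonneg)
  also have "\<dots> = 4 / u / \<sigma> / (1 + y\<^sup>2)"
    using assms by (simp add: field_simps)
  finally show ?thesis by simp
qed

text \<open>Let \<open>d\<close> be the deviation of \<open>Q\<close> from
  \<open>- y\<^sup>2 / 2\<close> and use
  \<open>norm (exp d - 1) \<le> exp (norm d) * norm d\<close>. Two bounds on \<open>d\<close> serve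
  different purposes: \<open>y\<^sup>2 / 8 + 1\<close> in the exponent costs only part of the
  Gaussian, and \<open>(D * \<bar>y\<bar> ^ 3 + 1) / \<sigma>\<close> in the factor supplies the
  gain \<open>1 / \<sigma>\<close>. This is why \<open>E\<close> is bounded both by \<open>1\<close>
  and by \<open>1 / \<sigma>\<close>.\<close>

lemma exp_near_gaussian:
  fixes Q :: complex and y \<sigma> D E :: real
  assumes "\<sigma> > 0" "D \<ge> 0" "norm (Q + of_real (y\<^sup>2 / 2)) \<le> D * \<bar>y\<bar> ^ 3 / \<sigma> + E"
    and "D * \<bar>y\<bar> ^ 3 / \<sigma> \<le> y\<^sup>2 / 8" "E \<le> 1" "E \<le> 1 / \<sigma>"
  shows "norm (exp Q - of_real (exp (- y\<^sup>2 / 2))) \<le> 8 * exp 1 * (8 * D + 1) / \<sigma> / (1 + y\<^sup>2)"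
proof -
  define d where "d = Q + of_real (y\<^sup>2 / 2)"
  have d1: "norm d \<le> y\<^sup>2 / 8 + 1" using assms unfolding d_def by linarith
  have d2: "norm d \<le> (D * \<bar>y\<bar> ^ 3 + 1) / \<sigma>"
    using assms unfolding d_def by (simp add: add_divide_distrib)
  have "exp Q = exp (of_real (- y\<^sup>2 / 2)) * exp d"
    unfolding exp_add[symmetric] d_def by simp
  hence "exp Q - of_real (exp (- y\<^sup>2 / 2)) = of_real (exp (- y\<^sup>2 / 2)) * (exp d - 1)"
    unfolding exp_of_real by (simp add: algebra_simps)
  hence "norm (exp Q - of_real (exp (- y\<^sup>2 / 2))) = exp (- y\<^sup>2 / 2) * norm (exp d - 1)"
    by (simp add: norm_mult)
  also have "norm (exp d - 1) \<le> exp \<bar>Re d\<bar> * norm d"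
    using Taylor_exp[of d 0] by simp
  also have "\<dots> \<le> exp (y\<^sup>2 / 8 + 1) * ((D * \<bar>y\<bar> ^ 3 + 1) / \<sigma>)"
    using d1 abs_Re_le_cmod[of d] by (intro mult_mono d2) auto
  also have "exp (- y\<^sup>2 / 2) * \<dots> = exp 1 * exp (- (3 * y\<^sup>2 / 8)) * (D * \<bar>y\<bar> ^ 3 + 1) / \<sigma>"
  proof -
    have "- y\<^sup>2 / 2 + (y\<^sup>2 / 8 + 1) = 1 + - (3 * y\<^sup>2 / 8)" by simp
    hence "exp (- y\<^sup>2 / 2) * exp (y\<^sup>2 / 8 + 1) = exp 1 * exp (- (3 * y\<^sup>2 / 8))"
      unfolding exp_add[symmetric] by metis
    thus ?thesis by (metis mult.assoc times_divide_eq_right)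
  qed
  also have "\<dots> \<le> exp 1 * exp (- (3 * y\<^sup>2 / 8)) * (8 * (8 * D + 1) * exp (3 * y\<^sup>2 / 8) / (1 + y\<^sup>2)) / \<sigma>"
    using cubic_times_quadratic_le_exp[OF assms(2), of y] assms(1)
    by (intro divide_right_mono mult_left_mono)
       (auto simp: pos_le_divide_eq add_pos_nonneg)
  also have "\<dots> = 8 * exp 1 * (8 * D + 1) / \<sigma> / (1 + y\<^sup>2)"
  proof -
    have "exp (- a) * (b * exp a / c) = b / c" for a b c :: real
      by (simp add: exp_minus)
    thus ?thesis unfolding mult.assoc[of "exp 1"] by (simp add: mult_ac)
  qed
  finally show ?thesis by simp
qed

section \<open>The integrand along the contour, in three ranges of \<open>s\<close>\<close>

locale log_singularity = log_poly +
  fixes G :: "complex \<Rightarrow> complex" and K \<delta> :: real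
  assumes G_cont: "continuous_on (cball 0 1 - {1}) G"
    and K: "K \<ge> 0" and \<delta>: "\<delta> > 0"
    and G_near: "\<And>w. Re w > 0 \<Longrightarrow> norm w \<le> \<delta> \<Longrightarrow>
                   norm (G (exp (- w)) - cpoly P (- Ln w)) \<le> K * norm w"
begin

text \<open>At a saddle point \<open>v * P'(r) = n * exp (- r)\<close>, so \<open>2 * pi\<close>
  times the square of this quantity is the radicand in \<open>main_term\<close>.\<close>

definition sd :: "real \<Rightarrow> real \<Rightarrow> real" where
  "sd v r = sqrt (v * (poly (pderiv P) r + poly (pderiv (pderiv P)) r))"

text \<open>The contour is \<open>w = e\<^sup>-\<^sup>r (1 - \<i> s)\<close>, through the saddle point \<open>w = e\<^sup>-\<^sup>r\<close>; the exponent is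
  normalised to vanish to first order at \<open>s = 0\<close>.\<close>

definition vline :: "real \<Rightarrow> real \<Rightarrow> complex" where
  "vline r s = of_real (exp (- r)) * (1 - \<i> * of_real s)"

definition expo :: "real \<Rightarrow> real \<Rightarrow> real \<Rightarrow> complex" where
  "expo v r s = of_real v * (G (exp (- vline r s)) - of_real (poly P r))
                 - of_real (v * poly (pderiv P) r) * (\<i> * of_real s)"

lemma norm_one_minus_ii: "norm (1 - \<i> * of_real s) = sqrt (1 + s\<^sup>2)"
  by (simp add: cmod_def)

lemma Re_vline: "Re (vline r s) = exp (- r)" and Im_vline: "Im (vline r s) = - exp (- r) * s"
  by (simp_all add: vline_def Re_exp Im_exp exp_of_real[symmetric])

lemma norm_vline: "norm (vline r s) = exp (- r) * sqrt (1 + s\<^sup>2)"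
  unfolding vline_def norm_mult norm_one_minus_ii norm_of_real by simp

lemma neg_Ln_vline: "- Ln (vline r s) = of_real r - Ln (1 - \<i> * of_real s)"
proof -
  have "1 - \<i> * of_real s \<noteq> 0" by (simp add: complex_eq_iff)
  moreover have "Ln (of_real (exp (- r))) = - complex_of_real r"
    by (subst Ln_of_real) auto
  ultimately show ?thesis unfolding vline_def by (subst Ln_times_of_real) auto
qed

lemma sd_bounds:
  assumes "0 < v1" "v1 \<le> v2"
  obtains c1 c2 where "c1 > 0" "c2 > 0"
    "\<forall>\<^sub>F r in at_top. \<forall>v\<in>{v1..v2}. sd v r > 0 \<and> c1 * r ^ k \<le> (sd v r)\<^sup>2 \<and> (sd v r)\<^sup>2 \<le> c2 * r ^ k"
proof -
  from deriv2_le obtain C2 where C2: "C2 \<ge> 0"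
    "\<And>r. r \<ge> 1 \<Longrightarrow> \<bar>poly (pderiv (pderiv P)) r\<bar> \<le> C2 * r ^ k" by blast
  show ?thesis
  proof (rule that[of "v1 / 2" "v2 * (2 + C2)"])
    show "\<forall>\<^sub>F r in at_top. \<forall>v\<in>{v1..v2}. sd v r > 0 \<and> v1 / 2 * r ^ k \<le> (sd v r)\<^sup>2
        \<and> (sd v r)\<^sup>2 \<le> v2 * (2 + C2) * r ^ k"
      using deriv_bounds deriv2_nonneg eventually_ge_at_top[of 1]
    proof eventually_elim
      case (elim r)
      show ?case
      proof
        fix v assume v: "v \<in> {v1..v2}"
        let ?q = "poly (pderiv P) r + poly (pderiv (pderiv P)) r"
        have q: "r ^ k / 2 \<le> ?q" "?q \<le> (2 + C2) * r ^ k"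
          using elim C2(2)[of r] by (auto simp: algebra_simps)
        have rk: "r ^ k > 0" using elim by simp
        have "v1 * (r ^ k / 2) \<le> v * ?q" "v * ?q \<le> v2 * ((2 + C2) * r ^ k)"
          using v q rk assms C2(1) by (intro mult_mono; force)+
        moreover have "0 < v1 * (r ^ k / 2)" using assms rk by simp
        ultimately show "sd v r > 0 \<and> v1 / 2 * r ^ k \<le> (sd v r)\<^sup>2 \<and> (sd v r)\<^sup>2 \<le> v2 * (2 + C2) * r ^ k"
          unfolding sd_def by (auto simp: algebra_simps)
      qed
    qed
  qed (use assms C2 in \<open>auto intro!: mult_pos_pos\<close>)
qed

text \<open>Apply the Taylor expansion with \<open>z = - \<i> * s\<close>: the linear terms cancel,
  the quadratic one is \<open>- (sd v r * s)\<^sup>2 / 2\<close>, and what remains is a cubic error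
  together with the error of order \<open>exp (- r)\<close> between \<open>G\<close> and
  \<open>P\<close>.\<close>

lemma expo_central:
  assumes v: "0 < v1" "v1 \<le> v2"
  obtains u C where "0 < u" "C > 0"
    "\<forall>\<^sub>F r in at_top. \<forall>v\<in>{v1..v2}. \<forall>s. \<bar>s\<bar> \<le> u \<longrightarrow>
       norm (exp (expo v r s) - of_real (exp (- (sd v r * s)\<^sup>2 / 2)))
         \<le> C / sd v r / (1 + (sd v r * s)\<^sup>2)"
proof -
  from saddle_exponent_taylor obtain C3 where C3: "C3 \<ge> 0" "\<forall>\<^sub>F r in at_top. \<forall>z. norm z \<le> 1 / 4 \<longrightarrow>
    norm (cpoly P (of_real r - Ln (1 + z)) - of_real (poly P r) + of_real (poly (pderiv P) r) * z
          - of_real (poly (pderiv P) r + poly (pderiv (pderiv P)) r) * z\<^sup>2 / 2)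
      \<le> C3 * r ^ k * norm z ^ 3" by blast
  from sd_bounds[OF v] obtain c1 c2 where c: "c1 > 0" "c2 > 0"
    "\<forall>\<^sub>F r in at_top. \<forall>v\<in>{v1..v2}. sd v r > 0 \<and> c1 * r ^ k \<le> (sd v r)\<^sup>2 \<and> (sd v r)\<^sup>2 \<le> c2 * r ^ k"
    by blast
  \<comment> \<open>This constant turns the cubic error
    \<open>v2 * C3 * r ^ k * \<bar>s\<bar> ^ 3\<close> into
    \<open>D * \<bar>y\<bar> ^ 3 / \<sigma>\<close> with \<open>y = \<sigma> * s\<close>, using
    \<open>c1 * r ^ k \<le> \<sigma>\<^sup>2\<close>.\<close>
  define D where "D = v2 * C3 / c1"
  have D: "D \<ge> 0" using v C3 c by (simp add: D_def)
  \<comment> \<open>\<open>1 / 4\<close> is the range of the Taylor expansion; the other bound gives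
    \<open>D * u \<le> 1 / 8\<close>, which keeps the cubic error below
    \<open>y\<^sup>2 / 8\<close>.\<close>
  define u where "u = min (1 / 4) (1 / (8 * (D + 1)))"
  have u: "u > 0" "u \<le> 1 / 4" using D by (auto simp: u_def)
  have "u \<le> 1 / (8 * (D + 1))" by (simp add: u_def)
  hence "u * (8 * (D + 1)) \<le> 1" using D by (simp add: pos_le_divide_eq)
  hence Du: "D * u \<le> 1 / 8" using u by (simp add: algebra_simps)
  \<comment> \<open>The first estimate, combined with \<open>\<sigma> \<le> exp (r / 2)\<close>,
    puts the error of \<open>G\<close> below \<open>1 / \<sigma>\<close>; the second keeps the
    contour within the range \<delta> of the expansion of \<open>G\<close>.\<close>
  have "\<forall>\<^sub>F r in at_top. 2 * v2 * K * exp (- r) * exp (r / 2) \<le> 1" "\<forall>\<^sub>F r::real in at_top. 2 * exp (- r) \<le> \<delta>"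
    using \<delta> by real_asymp+
  note ev = C3(2) c(3) this power_le_exp_half[of c2 k] eventually_ge_at_top[of 1]
  have "\<forall>\<^sub>F r in at_top. \<forall>v\<in>{v1..v2}. \<forall>s. \<bar>s\<bar> \<le> u \<longrightarrow>
       norm (exp (expo v r s) - of_real (exp (- (sd v r * s)\<^sup>2 / 2)))
         \<le> (8 * exp 1 * (8 * D + 1)) / sd v r / (1 + (sd v r * s)\<^sup>2)"
    using ev
  proof eventually_elim
    case (elim r)
    show ?case
    proof (intro ballI allI impI)
      fix v s assume vv: "v \<in> {v1..v2}" and s: "\<bar>s\<bar> \<le> u"
      define \<sigma> where "\<sigma> = sd v r"
      have \<sigma>: "\<sigma> > 0" "c1 * r ^ k \<le> \<sigma>\<^sup>2" "\<sigma>\<^sup>2 \<le> c2 * r ^ k" using elim vv by (auto simp: \<sigma>_def)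
      define y where "y = \<sigma> * s"
      define z where "z = - (\<i> * complex_of_real s)"
      have z: "norm z = \<bar>s\<bar>" "z\<^sup>2 = - of_real (s\<^sup>2)" by (simp_all add: z_def norm_mult power_mult_distrib)
      have w: "norm (vline r s) \<le> 2 * exp (- r)"
      proof -
        have "s\<^sup>2 \<le> 1" using s u by (simp add: abs_square_le_1)
        hence "sqrt (1 + s\<^sup>2) \<le> sqrt (2\<^sup>2)" by (intro real_sqrt_le_mono) simp
        thus ?thesis unfolding norm_vline by simp
      qed
      define e1 where "e1 = G (exp (- vline r s)) - cpoly P (- Ln (vline r s))"
      define e2 where "e2 = cpoly P (of_real r - Ln (1 + z)) - of_real (poly P r)
          + of_real (poly (pderiv P) r) * z
          - of_real (poly (pderiv P) r + poly (pderiv (pderiv P)) r) * z\<^sup>2 / 2"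
      have "norm e1 \<le> K * norm (vline r s)"
        unfolding e1_def using w elim by (intro G_near) (auto simp: Re_vline)
      also have "\<dots> \<le> K * (2 * exp (- r))" using w K by (rule mult_left_mono)
      finally have ne1: "norm e1 \<le> K * (2 * exp (- r))" .
      have "norm z \<le> 1 / 4" using s u z by simp
      with elim have ne2: "norm e2 \<le> C3 * r ^ k * \<bar>s\<bar> ^ 3"
        unfolding e2_def z(1)[symmetric] by blast
      have lam: "\<sigma>\<^sup>2 = v * (poly (pderiv P) r + poly (pderiv (pderiv P)) r)"
      proof -
        have "\<sigma> \<noteq> 0" using \<sigma> by simp
        hence "v * (poly (pderiv P) r + poly (pderiv (pderiv P)) r) \<ge> 0"
          using \<sigma>(1) unfolding \<sigma>_def sd_def by (metis less_imp_le real_sqrt_gt_0_iff)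
        thus ?thesis unfolding \<sigma>_def sd_def by simp
      qed
      have "expo v r s + of_real (y\<^sup>2 / 2) = of_real v * (e1 + e2)"
      proof -
        have "of_real (y\<^sup>2 / 2) = - (of_real (\<sigma>\<^sup>2) * z\<^sup>2 / 2)"
          unfolding z(2) y_def by (simp add: power_mult_distrib)
        also have "\<dots> = - (of_real v * (of_real (poly (pderiv P) r + poly (pderiv (pderiv P)) r) * z\<^sup>2 / 2))"
          unfolding lam by simp
        finally have 1: "of_real (y\<^sup>2 / 2) = - (of_real v * (of_real (poly (pderiv P) r + poly (pderiv (pderiv P)) r) * z\<^sup>2 / 2))" .
        have 2: "- Ln (vline r s) = of_real r - Ln (1 + z)" by (simp add: neg_Ln_vline z_def)
        show ?thesis unfolding 1 expo_def e1_def e2_def 2 by (simp add: z_def algebra_simps)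
      qed
      hence "norm (expo v r s + of_real (y\<^sup>2 / 2)) = v * norm (e1 + e2)"
        using vv v by (simp add: norm_mult)
      also have "\<dots> \<le> v2 * (K * (2 * exp (- r)) + C3 * r ^ k * \<bar>s\<bar> ^ 3)"
        using vv v ne1 ne2 by (intro mult_mono order_trans[OF norm_triangle_ineq] add_mono) auto
      finally have main0: "norm (expo v r s + of_real (y\<^sup>2 / 2))
          \<le> v2 * (K * (2 * exp (- r)) + C3 * r ^ k * \<bar>s\<bar> ^ 3)" .
      have "v2 * (C3 * r ^ k * \<bar>s\<bar> ^ 3) \<le> D * \<bar>y\<bar> ^ 3 / \<sigma>"
      proof -
        have "v2 * (C3 * r ^ k * \<bar>s\<bar> ^ 3) = D * ((c1 * r ^ k) * \<bar>s\<bar> ^ 3)"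
          using c by (simp add: D_def)
        also have "\<dots> \<le> D * (\<sigma>\<^sup>2 * \<bar>s\<bar> ^ 3)"
          using \<sigma> D by (intro mult_left_mono mult_right_mono) auto
        also have "\<dots> = D * \<bar>y\<bar> ^ 3 / \<sigma>"
          using \<sigma> by (simp add: y_def abs_mult power2_eq_square power3_eq_cube)
        finally show ?thesis .
      qed
      with main0 have main: "norm (expo v r s + of_real (y\<^sup>2 / 2)) \<le> D * \<bar>y\<bar> ^ 3 / \<sigma> + 2 * v2 * K * exp (- r)"
        by (simp add: algebra_simps)
      have "\<sigma> \<le> 1 + \<sigma>\<^sup>2"
        using zero_le_power2[of "\<sigma> - 1"] \<sigma>(1) by (simp add: power2_eq_square algebra_simps)
      also have "\<dots> \<le> exp (r / 2)" using elim \<sigma> by linarith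
      finally have \<sigma>e: "\<sigma> \<le> exp (r / 2)" .
      have E0: "0 \<le> 2 * v2 * K * exp (- r)" using v K by simp
      from mult_left_mono[OF \<sigma>e E0] elim have "2 * v2 * K * exp (- r) * \<sigma> \<le> 1" by linarith
      hence E1: "2 * v2 * K * exp (- r) \<le> 1 / \<sigma>" using \<sigma> by (simp add: pos_le_divide_eq)
      have "1 \<le> exp (r / 2)" using elim by simp
      from mult_left_mono[OF this E0] elim have E2: "2 * v2 * K * exp (- r) \<le> 1" by linarith
      have "D * \<bar>y\<bar> ^ 3 / \<sigma> = (D * \<bar>s\<bar>) * y\<^sup>2"
        using \<sigma> by (simp add: y_def abs_mult power2_eq_square power3_eq_cube)
      also have "\<dots> \<le> (1 / 8) * y\<^sup>2"
        using mult_left_mono[OF s D] Du by (intro mult_right_mono) auto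
      finally have Dy: "D * \<bar>y\<bar> ^ 3 / \<sigma> \<le> y\<^sup>2 / 8" by simp
      from exp_near_gaussian[OF \<sigma>(1) D main Dy E2 E1]
      show "norm (exp (expo v r s) - of_real (exp (- (sd v r * s)\<^sup>2 / 2)))
         \<le> (8 * exp 1 * (8 * D + 1)) / sd v r / (1 + (sd v r * s)\<^sup>2)"
        unfolding y_def \<sigma>_def .
    qed
  qed
  moreover have "8 * exp 1 * (8 * D + 1) > 0" using D by simp
  ultimately show ?thesis using that[of u] u by blast
qed

text \<open>Here \<open>\<bar>w\<bar> = exp (- (r - l))\<close> with
  \<open>l = ln (1 + s\<^sup>2) / 2\<close>, which is bounded below because
  \<open>\<bar>s\<bar> \<ge> u\<close>. The real part of the exponent drops by a multiple of
  \<open>r ^ k * l\<close>, so the integrand is at most a constant times a power of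
  \<open>1 + s\<^sup>2\<close> whose exponent tends to minus infinity with \<open>r\<close>. That
  beats the weight, which is polynomial in \<open>r ^ k\<close> and linear in
  \<open>1 + s\<^sup>2\<close>.\<close>

lemma expo_middle:
  assumes v: "0 < v1" "v1 \<le> v2" and u: "u > 0"
  obtains d C where "d > 0" "C > 0"
    "\<forall>\<^sub>F r in at_top. \<forall>v\<in>{v1..v2}. \<forall>s. \<bar>s\<bar> \<ge> u \<and> norm (vline r s) \<le> d \<longrightarrow>
       norm (exp (expo v r s)) \<le> C / sd v r / (1 + (sd v r * s)\<^sup>2)"
proof -
  from Re_cpoly_vertical_le obtain C4 where C4: "C4 \<ge> 0" "\<And>R \<phi>. R \<ge> 1 \<Longrightarrow> \<bar>\<phi>\<bar> \<le> 2 \<Longrightarrow>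
    Re (cpoly P (of_real R + \<i> * of_real \<phi>)) \<le> poly P R + C4 * R ^ (k - 1)" by blast
  from increment_lower_bound obtain R1 where R1: "R1 \<ge> 1"
    "\<And>R r. R1 \<le> R \<Longrightarrow> R \<le> r \<Longrightarrow> r ^ k * (r - R) / (2 * real (Suc k)) \<le> poly P r - poly P R" by blast
  from sd_bounds[OF v] obtain c1 c2 where c: "c1 > 0" "c2 > 0"
    "\<forall>\<^sub>F r in at_top. \<forall>v\<in>{v1..v2}. sd v r > 0 \<and> c1 * r ^ k \<le> (sd v r)\<^sup>2 \<and> (sd v r)\<^sup>2 \<le> c2 * r ^ k"
    by blast
  \<comment> \<open>With \<open>d = exp (- R0)\<close>, the condition
    \<open>norm (vline r s) \<le> d\<close> says \<open>r - l \<ge> R0\<close>; then the lower bound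
    for increments of \<open>P\<close> and the expansion of \<open>G\<close> both apply.\<close>
  define R0 where "R0 = max R1 (- ln \<delta>)"
  define d where "d = exp (- R0)"
  have d: "d > 0" "d \<le> \<delta>"
  proof -
    have "exp (- R0) \<le> exp (ln \<delta>)" unfolding exp_le_cancel_iff by (simp add: R0_def)
    thus "d \<le> \<delta>" using \<delta> by (simp add: d_def)
  qed (simp add: d_def)
  define b where "b = 1 / (2 * real (Suc k))"
  have b: "b > 0" by (simp add: b_def)
  define l0 where "l0 = ln (1 + u\<^sup>2) / 2"
  have l0: "l0 > 0" using u by (simp add: l0_def ln_gt_zero)
  \<comment> \<open>Half of the drop \<open>b * l * r ^ k\<close> of \<open>P\<close> is given up to
    absorb the vertical correction of order \<open>r ^ (k - 1)\<close>.\<close>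
  define m where "m = v1 * b / 2"
  have m: "m > 0" using v b by (simp add: m_def)
  \<comment> \<open>The \<open>2\<close> accounts for \<open>1 + s\<^sup>2 = exp (2 * l)\<close> in
    the weight. Since \<open>m * t \<ge> 2\<close>, the exponential is nonincreasing in
    \<open>l\<close>, so the worst case is \<open>l = l0\<close>.\<close>
  have "\<forall>\<^sub>F t in at_top. exp (- (m * t - 2) * l0) * (1 + c2 * t)\<^sup>2 \<le> 1 \<and> m * t \<ge> 2"
    using m l0 c by (intro eventually_conj) real_asymp+
  moreover have "filterlim (\<lambda>r::real. r ^ k) at_top at_top"
    using k by (intro filterlim_pow_at_top filterlim_ident) auto
  ultimately have ev1: "\<forall>\<^sub>F r in at_top. exp (- (m * r ^ k - 2) * l0) * (1 + c2 * r ^ k)\<^sup>2 \<le> 1 \<and> m * r ^ k \<ge> 2"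
    by (rule eventually_compose_filterlim)
  \<comment> \<open>The threshold \<open>2 * C4 / (b * l0)\<close> is what makes
    \<open>C4 * r ^ (k - 1)\<close> at most half of \<open>b * l * r ^ k\<close>.\<close>
  note ev = ev1 c(3) eventually_ge_at_top[of "max R0 (2 * C4 / (b * l0))"]
  have "\<forall>\<^sub>F r in at_top. \<forall>v\<in>{v1..v2}. \<forall>s. \<bar>s\<bar> \<ge> u \<and> norm (vline r s) \<le> d \<longrightarrow>
       norm (exp (expo v r s)) \<le> exp (v2 * K * d) / sd v r / (1 + (sd v r * s)\<^sup>2)"
    using ev
  proof eventually_elim
    case (elim r)
    show ?case
    proof (intro ballI allI impI; elim conjE)
      fix v s assume vv: "v \<in> {v1..v2}" and s: "\<bar>s\<bar> \<ge> u" and w: "norm (vline r s) \<le> d"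
      define \<sigma> where "\<sigma> = sd v r"
      have \<sigma>: "\<sigma> > 0" "\<sigma>\<^sup>2 \<le> c2 * r ^ k" using elim vv by (auto simp: \<sigma>_def)
      define z where "z = 1 - \<i> * complex_of_real s"
      have z0: "z \<noteq> 0" "Re z \<ge> 0" by (auto simp: z_def complex_eq_iff)
      define l where "l = ln (1 + s\<^sup>2) / 2"
      define \<phi> where "\<phi> = Im (Ln z)"
      have \<phi>: "\<bar>- \<phi>\<bar> \<le> 2"
        using Re_Ln_pos_le[OF z0(1)] z0(2) pi_half_less_two unfolding \<phi>_def by linarith
      have "1 + s\<^sup>2 > 0" by (intro add_pos_nonneg) auto
      hence "Re (Ln z) = l"
        using z0 by (simp add: z_def norm_one_minus_ii l_def ln_sqrt)
      hence Lz: "Ln z = of_real l + \<i> * of_real \<phi>" unfolding \<phi>_def by (simp add: complex_eq_iff)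
      have "u\<^sup>2 \<le> s\<^sup>2" using s u by (metis abs_le_square_iff abs_of_pos)
      hence ll: "l \<ge> l0" unfolding l_def l0_def by (intro divide_right_mono ln_mono) (auto intro: add_pos_nonneg)
      have e2l: "exp (2 * l) = 1 + s\<^sup>2" using \<open>1 + s\<^sup>2 > 0\<close> by (simp add: l_def)
      have "exp (- (r - l)) = norm (vline r s)"
      proof -
        have "exp l = sqrt (1 + s\<^sup>2)"
          using e2l by (intro real_sqrt_unique[symmetric]) (simp_all add: exp_double[symmetric])
        thus ?thesis unfolding norm_vline by (simp add: exp_diff exp_minus divide_inverse mult.commute)
      qed
      with w have rl: "r - l \<ge> R0" unfolding d_def by (metis exp_le_cancel_iff neg_le_iff_le)
      have r1: "r \<ge> 1" "R0 \<ge> 1" "R0 \<ge> R1" using elim R1 by (auto simp: R0_def)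
      have rk: "r ^ k = r * r ^ (k - 1)" using k by (cases k) auto
      have "Re (G (exp (- vline r s))) \<le> Re (cpoly P (- Ln (vline r s))) + K * d"
      proof -
        have "norm (G (exp (- vline r s)) - cpoly P (- Ln (vline r s))) \<le> K * norm (vline r s)"
          using w d by (intro G_near) (auto simp: Re_vline)
        also have "\<dots> \<le> K * d" using w K by (rule mult_left_mono)
        finally show ?thesis using complex_Re_le_cmod[of "G (exp (- vline r s)) - cpoly P (- Ln (vline r s))"] by simp
      qed
      also have "- Ln (vline r s) = of_real (r - l) + \<i> * of_real (- \<phi>)"
        using Lz unfolding neg_Ln_vline z_def by simp
      also have "Re (cpoly P \<dots>) \<le> poly P (r - l) + C4 * (r - l) ^ (k - 1)"
        using rl r1 \<phi> by (intro C4) auto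
      also have "C4 * (r - l) ^ (k - 1) \<le> C4 * r ^ (k - 1)"
        using rl r1 ll l0 C4 by (intro mult_left_mono power_mono) auto
      also have "\<dots> \<le> b * l * r ^ k / 2"
      proof -
        have "C4 \<le> b * l0 * r / 2" using elim b l0 by (simp add: pos_divide_le_eq mult_ac)
        also have "\<dots> \<le> b * l * r / 2" using ll b r1 by (intro divide_right_mono mult_right_mono mult_left_mono) auto
        finally have "C4 * r ^ (k - 1) \<le> b * l * r / 2 * r ^ (k - 1)" using r1 by (intro mult_right_mono) auto
        thus ?thesis by (simp add: rk mult_ac)
      qed
      also have "poly P (r - l) \<le> poly P r - b * l * r ^ k"
        using R1(2)[of "r - l" r] rl r1 ll l0 by (simp add: b_def mult_ac)
      finally have "Re (G (exp (- vline r s))) - poly P r \<le> K * d - b * l * r ^ k / 2"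
        by simp
      hence "v * (Re (G (exp (- vline r s))) - poly P r) \<le> v * (K * d - b * l * r ^ k / 2)"
        using vv v by (intro mult_left_mono) auto
      also have "\<dots> \<le> v2 * K * d - m * r ^ k * l"
      proof -
        have "v * (K * d) \<le> v2 * (K * d)" using vv K d by (intro mult_right_mono) auto
        moreover have "v1 * (b * l * r ^ k / 2) \<le> v * (b * l * r ^ k / 2)"
          using vv b ll l0 r1 by (intro mult_right_mono) auto
        ultimately show ?thesis by (simp add: m_def algebra_simps)
      qed
      finally have Q: "Re (expo v r s) \<le> v2 * K * d - m * r ^ k * l"
        by (simp add: expo_def)
      have \<sigma>1: "\<sigma> \<le> 1 + \<sigma>\<^sup>2"
        using zero_le_power2[of "\<sigma> - 1"] \<sigma>(1) by (simp add: power2_eq_square algebra_simps)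
      have "\<sigma> * (1 + (\<sigma> * s)\<^sup>2) \<le> (1 + \<sigma>\<^sup>2) * ((1 + \<sigma>\<^sup>2) * (1 + s\<^sup>2))"
        using \<sigma>1 \<sigma>(1) by (intro mult_mono) (auto simp: algebra_simps)
      also have "\<dots> \<le> (1 + c2 * r ^ k) * ((1 + c2 * r ^ k) * (1 + s\<^sup>2))"
        using \<sigma> by (intro mult_mono) (auto intro: add_nonneg_nonneg order_trans[OF zero_le_power2])
      also have "\<dots> = (1 + c2 * r ^ k)\<^sup>2 * exp (2 * l)"
        by (simp add: e2l power2_eq_square)
      finally have \<sigma>2: "\<sigma> * (1 + (\<sigma> * s)\<^sup>2) \<le> (1 + c2 * r ^ k)\<^sup>2 * exp (2 * l)" .
      have "norm (exp (expo v r s)) * (\<sigma> * (1 + (\<sigma> * s)\<^sup>2))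
          \<le> exp (v2 * K * d - m * r ^ k * l) * ((1 + c2 * r ^ k)\<^sup>2 * exp (2 * l))"
        using Q \<sigma>(1) by (intro mult_mono \<sigma>2) (auto intro: mult_nonneg_nonneg)
      also have "\<dots> = exp (v2 * K * d) * (exp (- (m * r ^ k - 2) * l) * (1 + c2 * r ^ k)\<^sup>2)"
      proof -
        have "v2 * K * d - m * r ^ k * l + 2 * l = v2 * K * d + - (m * r ^ k - 2) * l"
          by (simp add: algebra_simps)
        hence "exp (v2 * K * d - m * r ^ k * l) * exp (2 * l) = exp (v2 * K * d) * exp (- (m * r ^ k - 2) * l)"
          unfolding exp_add[symmetric] by metis
        hence "exp (v2 * K * d - m * r ^ k * l) * exp (2 * l) * (1 + c2 * r ^ k)\<^sup>2
            = exp (v2 * K * d) * exp (- (m * r ^ k - 2) * l) * (1 + c2 * r ^ k)\<^sup>2"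
          by (rule arg_cong)
        thus ?thesis by (simp only: mult.assoc mult.commute[of "(1 + c2 * r ^ k)\<^sup>2"])
      qed
      also have "\<dots> \<le> exp (v2 * K * d) * (exp (- (m * r ^ k - 2) * l0) * (1 + c2 * r ^ k)\<^sup>2)"
        using elim mult_left_mono_neg[OF ll, of "- (m * r ^ k - 2)"]
        by (intro mult_left_mono mult_right_mono) auto
      also have "\<dots> \<le> exp (v2 * K * d) * 1"
        using elim by (intro mult_left_mono) auto
      finally show "norm (exp (expo v r s)) \<le> exp (v2 * K * d) / sd v r / (1 + (sd v r * s)\<^sup>2)"
        using \<sigma>(1) unfolding \<sigma>_def[symmetric]
        by (simp add: pos_le_divide_eq add_pos_nonneg mult.assoc mult.commute[of \<sigma>])
    qed
  qed
  thus ?thesis using that[of d "exp (v2 * K * d)"] d by simp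
qed

text \<open>Away from \<open>w = 0\<close> the function \<open>G\<close> is bounded by compactness,
  whereas \<open>P r\<close> grows at least quadratically. So \<open>exp (- v * P r)\<close> beats
  the weight, which on the segment is at most of order \<open>exp (3 * r)\<close>.\<close>

lemma expo_far:
  assumes v: "0 < v1" "v1 \<le> v2" and d: "d > 0"
  obtains C where "C > 0"
    "\<forall>\<^sub>F r in at_top. \<forall>v\<in>{v1..v2}. \<forall>s. norm (vline r s) \<ge> d \<and> exp (- r) * \<bar>s\<bar> \<le> pi \<longrightarrow>
       norm (exp (expo v r s)) \<le> C / sd v r / (1 + (sd v r * s)\<^sup>2)"
proof -
  from increment_lower_bound obtain R1 where R1: "R1 \<ge> 1"
    "\<And>R r. R1 \<le> R \<Longrightarrow> R \<le> r \<Longrightarrow> r ^ k * (r - R) / (2 * real (Suc k)) \<le> poly P r - poly P R" by blast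
  from sd_bounds[OF v] obtain c1 c2 where c: "c1 > 0" "c2 > 0"
    "\<forall>\<^sub>F r in at_top. \<forall>v\<in>{v1..v2}. sd v r > 0 \<and> c1 * r ^ k \<le> (sd v r)\<^sup>2 \<and> (sd v r)\<^sup>2 \<le> c2 * r ^ k"
    by blast
  define S where "S = cbox (Complex 0 (- pi)) (Complex 1 pi) - ball 0 d"
  have "compact S" unfolding S_def by (intro compact_diff compact_cbox open_ball)
  moreover have "continuous_on S (\<lambda>w. G (exp (- w)))"
  proof (rule continuous_on_compose2[OF G_cont])
    show "(\<lambda>w. exp (- w)) ` S \<subseteq> cball 0 1 - {1}"
    proof (rule image_subsetI)
      fix w assume w: "w \<in> S"
      have nw: "norm w \<ge> d" and Rw: "Re w \<ge> 0" and Iw: "\<bar>Im w\<bar> \<le> pi"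
        using w by (auto simp: S_def in_cbox_complex_iff)
      \<comment> \<open>\<open>exp (- w) = 1\<close> forces \<open>w\<close> to be an integer
        multiple of \<open>2 * pi * \<i>\<close>; the bound on \<open>Im w\<close> leaves only
        \<open>0\<close>, which the removed ball excludes.\<close>
      have "exp (- w) \<noteq> 1"
      proof
        assume "exp (- w) = 1"
        then obtain n :: int where n: "Re (- w) = 0" "Im (- w) = of_int (2 * n) * pi"
          unfolding exp_eq_1 by blast
        have "n = 0"
        proof (rule ccontr)
          assume "n \<noteq> 0"
          hence "\<bar>real_of_int n\<bar> \<ge> 1" by linarith
          hence "2 * \<bar>real_of_int n\<bar> * pi \<ge> 2 * 1 * pi" by (intro mult_right_mono mult_left_mono) auto
          moreover have "\<bar>Im w\<bar> = 2 * \<bar>real_of_int n\<bar> * pi" using n(2) by (simp add: abs_mult flip: abs_minus_cancel[of "Im w"])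
          ultimately show False using Iw pi_gt_zero by linarith
        qed
        hence "w = 0" using n by (simp add: complex_eq_iff)
        thus False using nw d by simp
      qed
      thus "exp (- w) \<in> cball 0 1 - {1}" using Rw by simp
    qed
  qed (intro continuous_intros)
  ultimately have "bounded ((\<lambda>w. G (exp (- w))) ` S)"
    by (intro compact_imp_bounded compact_continuous_image)
  then obtain B where B: "B > 0" "\<And>w. w \<in> S \<Longrightarrow> norm (G (exp (- w))) \<le> B"
    unfolding bounded_pos by auto
  define b where "b = 1 / (2 * real (Suc k))"
  have b: "b > 0" by (simp add: b_def)
  \<comment> \<open>Lowering \<open>r ^ k\<close> to \<open>r\<close> in the bound for
    \<open>P\<close> still leaves quadratic growth.\<close>
  have "\<forall>\<^sub>F r in at_top. exp (v2 * B - v1 * (poly P R1 + b * (r * (r - R1)))) * (exp r * (1 + pi\<^sup>2 * exp (2 * r))) \<le> 1"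
    using v b by real_asymp
  \<comment> \<open>Nonnegativity of the lower bound for \<open>P r\<close> is what permits lowering
    \<open>v\<close> to \<open>v1\<close> in \<open>v * P r\<close>.\<close>
  moreover have "\<forall>\<^sub>F r in at_top. poly P R1 + b * (r * (r - R1)) \<ge> 0"
    using b by real_asymp
  moreover note c(3) power_le_exp_half[of c2 k] eventually_ge_at_top[of R1]
  ultimately have "\<forall>\<^sub>F r in at_top. \<forall>v\<in>{v1..v2}. \<forall>s. norm (vline r s) \<ge> d \<and> exp (- r) * \<bar>s\<bar> \<le> pi \<longrightarrow>
       norm (exp (expo v r s)) \<le> 1 / sd v r / (1 + (sd v r * s)\<^sup>2)"
  proof eventually_elim
    case (elim r)
    show ?case
    proof (intro ballI allI impI; elim conjE)
      fix v s assume vv: "v \<in> {v1..v2}" and w: "norm (vline r s) \<ge> d" and s: "exp (- r) * \<bar>s\<bar> \<le> pi"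
      define \<sigma> where "\<sigma> = sd v r"
      have \<sigma>: "\<sigma> > 0" "\<sigma>\<^sup>2 \<le> c2 * r ^ k" using elim vv by (auto simp: \<sigma>_def)
      have r1: "r \<ge> 1" using elim R1 by simp
      have "\<bar>Im (vline r s)\<bar> \<le> pi" using s by (simp add: Im_vline abs_mult)
      moreover have "0 \<le> Re (vline r s)" "Re (vline r s) \<le> 1" using r1 by (simp_all add: Re_vline)
      ultimately have "vline r s \<in> S"
        using w unfolding S_def in_cbox_complex_iff Diff_iff by (simp add: abs_le_iff)
      hence GB: "norm (G (exp (- vline r s))) \<le> B" by (rule B)
      have "poly P R1 + b * (r * (r - R1)) \<le> poly P R1 + b * (r ^ k * (r - R1))"
        using b r1 elim self_le_power[of r k] k by (intro add_left_mono mult_left_mono mult_right_mono) auto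
      also have "\<dots> \<le> poly P r" using R1(2)[of R1 r] elim by (simp add: b_def)
      finally have Pr: "poly P R1 + b * (r * (r - R1)) \<le> poly P r" .
      have "Re (expo v r s) = v * Re (G (exp (- vline r s))) - v * poly P r"
        by (simp add: expo_def algebra_simps)
      also have "\<dots> \<le> v2 * B - v1 * (poly P R1 + b * (r * (r - R1)))"
      proof (rule diff_mono)
        have "Re (G (exp (- vline r s))) \<le> B" using complex_Re_le_cmod GB by (rule order_trans)
        hence "v * Re (G (exp (- vline r s))) \<le> v * B" using vv v by (intro mult_left_mono) auto
        also have "\<dots> \<le> v2 * B" using vv B by (intro mult_right_mono) auto
        finally show "v * Re (G (exp (- vline r s))) \<le> v2 * B" .
        show "v1 * (poly P R1 + b * (r * (r - R1))) \<le> v * poly P r"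
          using vv v Pr elim by (intro mult_mono) auto
      qed
      finally have Q: "norm (exp (expo v r s)) \<le> exp (v2 * B - v1 * (poly P R1 + b * (r * (r - R1))))"
        by simp
      have \<sigma>1: "\<sigma> \<le> 1 + \<sigma>\<^sup>2"
        using zero_le_power2[of "\<sigma> - 1"] \<sigma>(1) by (simp add: power2_eq_square algebra_simps)
      have \<sigma>e: "1 + \<sigma>\<^sup>2 \<le> exp (r / 2)" using elim \<sigma> by linarith
      have ss: "s\<^sup>2 \<le> pi\<^sup>2 * exp (2 * r)"
      proof -
        have "\<bar>s\<bar> \<le> pi * exp r" using s by (simp add: exp_minus field_simps)
        hence "\<bar>s\<bar>\<^sup>2 \<le> (pi * exp r)\<^sup>2" by (intro power_mono) auto
        thus ?thesis by (simp add: power_mult_distrib exp_double)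
      qed
      have "\<sigma> * (1 + (\<sigma> * s)\<^sup>2) \<le> (1 + \<sigma>\<^sup>2) * ((1 + \<sigma>\<^sup>2) * (1 + s\<^sup>2))"
        using \<sigma>1 \<sigma>(1) by (intro mult_mono) (auto simp: algebra_simps)
      also have "\<dots> \<le> exp (r / 2) * (exp (r / 2) * (1 + pi\<^sup>2 * exp (2 * r)))"
        using \<sigma>e ss by (intro mult_mono) auto
      also have "\<dots> = exp r * (1 + pi\<^sup>2 * exp (2 * r))"
        by (simp add: mult.assoc[symmetric] exp_add[symmetric])
      finally have \<sigma>2: "\<sigma> * (1 + (\<sigma> * s)\<^sup>2) \<le> exp r * (1 + pi\<^sup>2 * exp (2 * r))" .
      have "norm (exp (expo v r s)) * (\<sigma> * (1 + (\<sigma> * s)\<^sup>2))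
          \<le> exp (v2 * B - v1 * (poly P R1 + b * (r * (r - R1)))) * (exp r * (1 + pi\<^sup>2 * exp (2 * r)))"
        using \<sigma>(1) by (intro mult_mono \<sigma>2 Q) (auto intro: mult_nonneg_nonneg)
      also have "\<dots> \<le> 1" using elim by simp
      finally show "norm (exp (expo v r s)) \<le> 1 / sd v r / (1 + (sd v r * s)\<^sup>2)"
        using \<sigma>(1) unfolding \<sigma>_def[symmetric]
        by (simp add: pos_le_divide_eq add_pos_nonneg mult.assoc mult.commute[of \<sigma>])
    qed
  qed
  thus ?thesis using that[of 1] by simp
qed

text \<open>The radii are chosen in order: \<open>u\<close> from the central range, then
  \<open>d\<close> depending on \<open>u\<close>, then the far range for this \<open>d\<close>.
  Outside the central range integrand and Gaussian are each small on their own, and the Gaussian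
  contributes the \<open>4 / u\<close>. The second conjunct treats \<open>s\<close> beyond the ends
  of the contour.\<close>

lemma expo_near_gaussian:
  assumes v: "0 < v1" "v1 \<le> v2"
  obtains C where "C > 0"
    "\<forall>\<^sub>F r in at_top. \<forall>v\<in>{v1..v2}. \<forall>s.
       (exp (- r) * \<bar>s\<bar> \<le> pi \<longrightarrow>
         norm (exp (expo v r s) - of_real (exp (- (sd v r * s)\<^sup>2 / 2)))
           \<le> C / sd v r / (1 + (sd v r * s)\<^sup>2)) \<and>
       (exp (- r) * \<bar>s\<bar> > pi \<longrightarrow>
         exp (- (sd v r * s)\<^sup>2 / 2) \<le> C / sd v r / (1 + (sd v r * s)\<^sup>2))"
proof -
  from expo_central[OF v] obtain u C1 where u: "0 < u" and C1: "C1 > 0"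
    "\<forall>\<^sub>F r in at_top. \<forall>v\<in>{v1..v2}. \<forall>s. \<bar>s\<bar> \<le> u \<longrightarrow>
       norm (exp (expo v r s) - of_real (exp (- (sd v r * s)\<^sup>2 / 2)))
         \<le> C1 / sd v r / (1 + (sd v r * s)\<^sup>2)" by blast
  from expo_middle[OF v u] obtain d C2 where d: "d > 0" and C2: "C2 > 0"
    "\<forall>\<^sub>F r in at_top. \<forall>v\<in>{v1..v2}. \<forall>s. \<bar>s\<bar> \<ge> u \<and> norm (vline r s) \<le> d \<longrightarrow>
       norm (exp (expo v r s)) \<le> C2 / sd v r / (1 + (sd v r * s)\<^sup>2)" by blast
  from expo_far[OF v d] obtain C3 where C3: "C3 > 0"
    "\<forall>\<^sub>F r in at_top. \<forall>v\<in>{v1..v2}. \<forall>s. norm (vline r s) \<ge> d \<and> exp (- r) * \<bar>s\<bar> \<le> pi \<longrightarrow>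
       norm (exp (expo v r s)) \<le> C3 / sd v r / (1 + (sd v r * s)\<^sup>2)" by blast
  obtain c1 c2 where
    "\<forall>\<^sub>F r in at_top. \<forall>v\<in>{v1..v2}. sd v r > 0 \<and> c1 * r ^ k \<le> (sd v r)\<^sup>2 \<and> (sd v r)\<^sup>2 \<le> c2 * r ^ k"
    using sd_bounds[OF v] by blast
  hence pos: "\<forall>\<^sub>F r in at_top. \<forall>v\<in>{v1..v2}. sd v r > 0"
    by eventually_elim blast
  have far: "\<forall>\<^sub>F r in at_top. exp (- r) * u \<le> pi" by real_asymp
  define C where "C = C1 + C2 + C3 + 4 / u"
  have C: "C1 \<le> C" "C2 + 4 / u \<le> C" "C3 + 4 / u \<le> C" "4 / u \<le> C" "C > 0"
    using u C1 C2 C3 by (auto simp: C_def add_pos_pos)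
  have "\<forall>\<^sub>F r in at_top. \<forall>v\<in>{v1..v2}. \<forall>s.
       (exp (- r) * \<bar>s\<bar> \<le> pi \<longrightarrow>
         norm (exp (expo v r s) - of_real (exp (- (sd v r * s)\<^sup>2 / 2)))
           \<le> C / sd v r / (1 + (sd v r * s)\<^sup>2)) \<and>
       (exp (- r) * \<bar>s\<bar> > pi \<longrightarrow>
         exp (- (sd v r * s)\<^sup>2 / 2) \<le> C / sd v r / (1 + (sd v r * s)\<^sup>2))"
    using C1(2) C2(2) C3(2) pos far
  proof eventually_elim
    case (elim r)
    show ?case
    proof (intro ballI allI)
      fix v s assume vv: "v \<in> {v1..v2}"
      define \<sigma> where "\<sigma> = sd v r"
      define y where "y = \<sigma> * s"
      have \<sigma>: "\<sigma> > 0" using elim vv by (simp add: \<sigma>_def)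
      have mono: "c / \<sigma> / (1 + y\<^sup>2) \<le> C / \<sigma> / (1 + y\<^sup>2)" if "c \<le> C" for c
        using that \<sigma> by (intro divide_right_mono) auto
      have gauss: "exp (- y\<^sup>2 / 2) \<le> 4 / u / \<sigma> / (1 + y\<^sup>2)" if "\<bar>s\<bar> \<ge> u"
        using that \<sigma> u by (intro gaussian_tail_le) (auto simp: y_def abs_mult)
      have outer: "norm (exp (expo v r s) - of_real (exp (- y\<^sup>2 / 2))) \<le> C / \<sigma> / (1 + y\<^sup>2)"
        if "\<bar>s\<bar> \<ge> u" "norm (exp (expo v r s)) \<le> c / \<sigma> / (1 + y\<^sup>2)" "c + 4 / u \<le> C" for c
      proof -
        have "norm (exp (expo v r s) - of_real (exp (- y\<^sup>2 / 2)))
            \<le> norm (exp (expo v r s)) + norm (complex_of_real (exp (- y\<^sup>2 / 2)))"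
          by (rule norm_triangle_ineq4)
        also have "\<dots> \<le> c / \<sigma> / (1 + y\<^sup>2) + 4 / u / \<sigma> / (1 + y\<^sup>2)"
          unfolding norm_of_real using that(2) gauss[OF that(1)] by simp
        also have "\<dots> = (c + 4 / u) / \<sigma> / (1 + y\<^sup>2)" by (simp add: add_divide_distrib)
        also have "\<dots> \<le> C / \<sigma> / (1 + y\<^sup>2)" by (rule mono) (rule that(3))
        finally show ?thesis .
      qed
      have "norm (exp (expo v r s) - of_real (exp (- y\<^sup>2 / 2))) \<le> C / \<sigma> / (1 + y\<^sup>2)"
        if s: "exp (- r) * \<bar>s\<bar> \<le> pi"
      proof -
        consider "\<bar>s\<bar> \<le> u" | "\<bar>s\<bar> \<ge> u" "norm (vline r s) \<le> d" | "\<bar>s\<bar> \<ge> u" "norm (vline r s) \<ge> d"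
          by linarith
        thus ?thesis
        proof cases
          case 1
          hence "norm (exp (expo v r s) - of_real (exp (- y\<^sup>2 / 2))) \<le> C1 / \<sigma> / (1 + y\<^sup>2)"
            using elim(1) vv unfolding y_def \<sigma>_def by blast
          also have "\<dots> \<le> C / \<sigma> / (1 + y\<^sup>2)" by (rule mono) (rule C)
          finally show ?thesis .
        next
          case 2
          with elim(2) vv show ?thesis unfolding y_def \<sigma>_def
            by (intro outer[unfolded y_def \<sigma>_def, OF _ _ C(2)]) blast+
        next
          case 3
          with elim(3) vv s show ?thesis unfolding y_def \<sigma>_def
            by (intro outer[unfolded y_def \<sigma>_def, OF _ _ C(3)]) blast+
        qed
      qed
      moreover have "exp (- y\<^sup>2 / 2) \<le> C / \<sigma> / (1 + y\<^sup>2)" if s: "exp (- r) * \<bar>s\<bar> > pi"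
      proof -
        have "exp (- r) * u < exp (- r) * \<bar>s\<bar>" using elim s by linarith
        hence "\<bar>s\<bar> \<ge> u" by simp
        from gauss[OF this] mono[OF C(4)] show ?thesis by linarith
      qed
      ultimately show "(exp (- r) * \<bar>s\<bar> \<le> pi \<longrightarrow>
         norm (exp (expo v r s) - of_real (exp (- (sd v r * s)\<^sup>2 / 2)))
           \<le> C / sd v r / (1 + (sd v r * s)\<^sup>2)) \<and>
       (exp (- r) * \<bar>s\<bar> > pi \<longrightarrow>
         exp (- (sd v r * s)\<^sup>2 / 2) \<le> C / sd v r / (1 + (sd v r * s)\<^sup>2))"
        unfolding y_def \<sigma>_def by blast
    qed
  qed
  thus ?thesis using that C by blast
qed

section \<open>From the integrand to the coefficients\<close>

lemma continuous_on_expo: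
  "continuous_on S (\<lambda>t. exp (expo v r (t * exp r)))"
proof -
  have "continuous_on S (\<lambda>t. G (exp (- vline r (t * exp r))))"
  proof (rule continuous_on_compose2[OF G_cont])
    show "continuous_on S (\<lambda>t. exp (- vline r (t * exp r)))"
      unfolding vline_def by (intro continuous_intros)
    have "norm (exp (- vline r s)) < 1" for s
      by (simp add: Re_vline)
    hence "exp (- vline r s) \<in> cball 0 1 - {1}" for s
      by (metis DiffI less_imp_le less_irrefl mem_cball_0 norm_one singletonD)
    thus "(\<lambda>t. exp (- vline r (t * exp r))) ` S \<subseteq> cball 0 1 - {1}"
      by (intro image_subsetI)
  qed
  thus ?thesis unfolding expo_def by (intro continuous_intros)
qed

text \<open>With \<open>s = t * exp r\<close> the factor \<open>exp (n * w)\<close> has exponent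
  \<open>n * exp (- r) * (1 - \<i> * s)\<close>. By the saddle point equation its imaginary part is
  \<open>- v * P'(r) * s\<close>, the linear term built into \<open>expo\<close>.\<close>

lemma coeff_eq_expo_integral:
  assumes hol: "g holomorphic_on ball 0 1" and gG: "\<And>t. norm t < 1 \<Longrightarrow> g t = G t"
    and saddle: "saddle_point P v n r"
  shows "fps_nth (fps_expansion (\<lambda>t. exp (of_real v * g t)) 0) n =
    of_real (exp (v * poly P r + real n * exp (- r)) / (2 * pi)) *
      integral {-pi..pi} (\<lambda>t. exp (expo v r (t * exp r)))"
proof -
  have eq: "exp (of_real v * g (exp (- (of_real (exp (- r)) - \<i> * of_real t)))) *
             exp (of_nat n * (of_real (exp (- r)) - \<i> * of_real t))
      = of_real (exp (v * poly P r + real n * exp (- r))) * exp (expo v r (t * exp r))" for t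
  proof -
    have w: "vline r (t * exp r) = of_real (exp (- r)) - \<i> * of_real t"
    proof -
      have "exp (- r) * (t * exp r) = t" by (simp add: exp_minus)
      hence "of_real (exp (- r)) * complex_of_real (t * exp r) = of_real t"
        by (metis of_real_mult)
      thus ?thesis unfolding vline_def by (simp only: right_diff_distrib mult.left_commute mult_1_right)
    qed
    have lam: "v * poly (pderiv P) r * exp r = real n"
      using saddle unfolding saddle_point_iff by (simp add: mult.assoc)
    have "norm (exp (- vline r (t * exp r))) < 1" by (simp add: Re_vline)
    hence gw: "g (exp (- vline r (t * exp r))) = G (exp (- vline r (t * exp r)))" by (rule gG)
    have "of_real (v * poly (pderiv P) r) * (\<i> * of_real (t * exp r))
        = \<i> * of_real t * of_real (v * poly (pderiv P) r * exp r)" by simp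
    also have "\<dots> = \<i> * of_real t * of_nat n" unfolding lam by simp
    finally have "of_real v * g (exp (- vline r (t * exp r))) + of_nat n * vline r (t * exp r)
        = of_real (v * poly P r + real n * exp (- r)) + expo v r (t * exp r)"
      unfolding expo_def gw by (simp add: w algebra_simps)
    hence "exp (of_real v * g (exp (- vline r (t * exp r))) + of_nat n * vline r (t * exp r))
        = exp (of_real (v * poly P r + real n * exp (- r)) + expo v r (t * exp r))"
      by (rule arg_cong)
    thus ?thesis unfolding w[symmetric] exp_add exp_of_real .
  qed
  have "(\<lambda>t. exp (of_real v * g t)) holomorphic_on ball 0 1"
    by (intro holomorphic_intros hol)
  from fps_expansion_nth_eq_integral[OF this, of "exp (- r)" n]
  show ?thesis unfolding eq by simp
qed

text \<open>The absolute error \<open>C * pi / (\<sigma> * a)\<close> of the integral, divided by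
  the Gaussian value \<open>sqrt (2 * pi) / a\<close>, is of order \<open>1 / \<sigma>\<close>, and
  \<sigma> is at least \<open>sqrt c1 * r powr (k / 2)\<close>.\<close>

lemma coeff_asymp:
  assumes hol: "g holomorphic_on ball 0 1" and gG: "\<And>t. norm t < 1 \<Longrightarrow> g t = G t"
    and v: "0 < v1" "v1 \<le> v2"
  obtains C where "C > 0"
    "\<forall>\<^sub>F r in at_top. \<forall>v\<in>{v1..v2}. \<forall>n. saddle_point P v n r \<longrightarrow>
       (\<exists>\<epsilon>. norm \<epsilon> \<le> C * r powr (- real k / 2) \<and>
          fps_nth (fps_expansion (\<lambda>t. exp (of_real v * g t)) 0) n
            = of_real (main_term P v n r) * (1 + \<epsilon>))"
proof -
  from expo_near_gaussian[OF v] obtain C where C: "C > 0"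
    "\<forall>\<^sub>F r in at_top. \<forall>v\<in>{v1..v2}. \<forall>s.
       (exp (- r) * \<bar>s\<bar> \<le> pi \<longrightarrow>
         norm (exp (expo v r s) - of_real (exp (- (sd v r * s)\<^sup>2 / 2)))
           \<le> C / sd v r / (1 + (sd v r * s)\<^sup>2)) \<and>
       (exp (- r) * \<bar>s\<bar> > pi \<longrightarrow>
         exp (- (sd v r * s)\<^sup>2 / 2) \<le> C / sd v r / (1 + (sd v r * s)\<^sup>2))" by blast
  from sd_bounds[OF v] obtain c1 c2 where c: "c1 > 0" "c2 > 0"
    "\<forall>\<^sub>F r in at_top. \<forall>v\<in>{v1..v2}. sd v r > 0 \<and> c1 * r ^ k \<le> (sd v r)\<^sup>2 \<and> (sd v r)\<^sup>2 \<le> c2 * r ^ k"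
    by blast
  have "\<forall>\<^sub>F r in at_top. \<forall>v\<in>{v1..v2}. \<forall>n. saddle_point P v n r \<longrightarrow>
       (\<exists>\<epsilon>. norm \<epsilon> \<le> (C * pi / sqrt c1) * r powr (- real k / 2) \<and>
          fps_nth (fps_expansion (\<lambda>t. exp (of_real v * g t)) 0) n
            = of_real (main_term P v n r) * (1 + \<epsilon>))"
    using C(2) c(3) eventually_ge_at_top[of 1]
  proof eventually_elim
    case (elim r)
    show ?case
    proof (intro ballI allI impI)
      fix v n assume vv: "v \<in> {v1..v2}" and saddle: "saddle_point P v n r"
      define \<sigma> where "\<sigma> = sd v r"
      have \<sigma>: "\<sigma> > 0" "c1 * r ^ k \<le> \<sigma>\<^sup>2" using elim vv by (auto simp: \<sigma>_def)
      \<comment> \<open>The inverse width of the Gaussian in the variable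
        \<open>t = s * exp (- r)\<close>.\<close>
      define a where "a = \<sigma> * exp r"
      have a: "a > 0" using \<sigma> by (simp add: a_def)
      define I where "I = integral {-pi..pi} (\<lambda>t. exp (expo v r (t * exp r)))"
      have at: "a * t = sd v r * (t * exp r)" and te: "exp (- r) * \<bar>t * exp r\<bar> = \<bar>t\<bar>" for t
        by (simp_all add: a_def \<sigma>_def abs_mult exp_minus)
      have I: "norm (I - of_real (sqrt (2 * pi) / a)) \<le> C / \<sigma> * pi / a"
        unfolding I_def
      proof (rule integral_near_gaussian[OF a continuous_on_expo])
        fix t :: real
        show "norm (exp (expo v r (t * exp r)) - of_real (exp (- (a * t)\<^sup>2 / 2)))
            \<le> C / \<sigma> / (1 + (a * t)\<^sup>2)" if "t \<in> {-pi..pi}"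
        proof -
          have "exp (- r) * \<bar>t * exp r\<bar> \<le> pi" unfolding te using that by auto
          with elim(1) vv show ?thesis unfolding at \<sigma>_def by blast
        qed
        show "exp (- (a * t)\<^sup>2 / 2) \<le> C / \<sigma> / (1 + (a * t)\<^sup>2)" if "t \<notin> {-pi..pi}"
        proof -
          have "exp (- r) * \<bar>t * exp r\<bar> > pi" unfolding te using that by auto
          with elim(1) vv show ?thesis unfolding at \<sigma>_def by blast
        qed
      qed
      define \<epsilon> where "\<epsilon> = of_real (a / sqrt (2 * pi)) * (I - of_real (sqrt (2 * pi) / a))"
      have I_eq: "I = of_real (sqrt (2 * pi) / a) * (1 + \<epsilon>)"
        using a by (simp add: \<epsilon>_def field_simps)
      have "norm \<epsilon> \<le> a / sqrt (2 * pi) * (C / \<sigma> * pi / a)"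
        unfolding \<epsilon>_def norm_mult norm_of_real using a by (intro mult_mono I) auto
      also have "\<dots> = C * pi / \<sigma> / sqrt (2 * pi)" using a by simp
      also have "\<dots> \<le> C * pi / \<sigma> / 1"
        using C(1) \<sigma>(1) pi_ge_two by (intro divide_left_mono) auto
      also have "\<dots> \<le> C * pi / (sqrt c1 * r powr (real k / 2))"
      proof -
        have rk: "r ^ k = (r powr (real k / 2))\<^sup>2"
        proof -
          have "(r powr (real k / 2))\<^sup>2 = r powr (real k / 2 + real k / 2)"
            unfolding power2_eq_square powr_add[symmetric] by simp
          thus ?thesis using elim by (simp add: powr_realpow)
        qed
        have "(sqrt c1 * r powr (real k / 2))\<^sup>2 \<le> \<sigma>\<^sup>2"
          using \<sigma>(2) c(1) unfolding power_mult_distrib rk[symmetric] by simp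
        hence le: "sqrt c1 * r powr (real k / 2) \<le> \<sigma>"
          by (rule power2_le_imp_le) (use \<sigma>(1) in simp)
        have pos: "sqrt c1 * r powr (real k / 2) > 0" using c(1) elim(3) by simp
        have "C * pi / \<sigma> \<le> C * pi / (sqrt c1 * r powr (real k / 2))"
          by (rule divide_left_mono[OF le])
             (use C(1) \<sigma>(1) pos in \<open>simp_all add: mult_pos_pos less_imp_le\<close>)
        thus ?thesis by simp
      qed
      also have "\<dots> = (C * pi / sqrt c1) * r powr (- real k / 2)"
      proof -
        have "r powr (- real k / 2) = inverse (r powr (real k / 2))"
          unfolding powr_minus[symmetric] by simp
        thus ?thesis by (simp only: divide_inverse inverse_mult_distrib mult.assoc)
      qed
      finally have bound: "norm \<epsilon> \<le> (C * pi / sqrt c1) * r powr (- real k / 2)" .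
      have lam: "v * poly (pderiv P) r = real n * exp (- r)"
        using saddle by (simp add: saddle_point_def)
      \<comment> \<open>The saddle point equation replaces \<open>v * P'(r)\<close> by
        \<open>n * exp (- r)\<close>, as in the radicand of \<open>main_term\<close>.\<close>
      have "\<sigma>\<^sup>2 = v * poly (pderiv (pderiv P)) r + real n * exp (- r)"
      proof -
        have "v * (poly (pderiv P) r + poly (pderiv (pderiv P)) r) \<ge> 0"
          using \<sigma>(1) unfolding \<sigma>_def sd_def by (metis less_imp_le real_sqrt_gt_0_iff)
        hence "\<sigma>\<^sup>2 = v * (poly (pderiv P) r + poly (pderiv (pderiv P)) r)"
          unfolding \<sigma>_def sd_def by simp
        thus ?thesis by (simp add: distrib_left lam)
      qed
      hence "2 * pi * v * poly (pderiv (pderiv P)) r + 2 * pi * real n * exp (- r) = 2 * pi * \<sigma>\<^sup>2"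
        by (simp add: algebra_simps)
      hence "main_term P v n r = exp (v * poly P r + real n * exp (- r)) / (exp r * (sqrt (2 * pi) * \<sigma>))"
        using \<sigma>(1) unfolding main_term_def by (simp add: real_sqrt_mult)
      also have "\<dots> = exp (v * poly P r + real n * exp (- r)) / (2 * pi) * (sqrt (2 * pi) / a)"
      proof -
        have "2 * pi = sqrt (2 * pi) * sqrt (2 * pi)" by simp
        hence "1 / (2 * pi) * (sqrt (2 * pi) / a) = 1 / (exp r * (sqrt (2 * pi) * \<sigma>))"
          using \<sigma>(1) unfolding a_def by (simp add: field_simps del: real_sqrt_mult_self)
        hence "b * (1 / (2 * pi) * (sqrt (2 * pi) / a)) = b * (1 / (exp r * (sqrt (2 * pi) * \<sigma>)))" for b
          by (rule arg_cong)
        thus ?thesis by simp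
      qed
      finally have mt: "main_term P v n r = exp (v * poly P r + real n * exp (- r)) / (2 * pi) * (sqrt (2 * pi) / a)" .
      have "fps_nth (fps_expansion (\<lambda>t. exp (of_real v * g t)) 0) n
          = of_real (exp (v * poly P r + real n * exp (- r)) / (2 * pi)) * I"
        unfolding I_def using gG by (intro coeff_eq_expo_integral hol saddle)
      also have "\<dots> = of_real (main_term P v n r) * (1 + \<epsilon>)"
        unfolding mt I_eq by (simp only: of_real_mult mult.assoc)
      finally have "fps_nth (fps_expansion (\<lambda>t. exp (of_real v * g t)) 0) n
          = of_real (main_term P v n r) * (1 + \<epsilon>)" .
      with bound show "\<exists>\<epsilon>. norm \<epsilon> \<le> (C * pi / sqrt c1) * r powr (- real k / 2) \<and>
          fps_nth (fps_expansion (\<lambda>t. exp (of_real v * g t)) 0) n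
            = of_real (main_term P v n r) * (1 + \<epsilon>)" by blast
    qed
  qed
  moreover have "C * pi / sqrt c1 > 0" using C c by simp
  ultimately show ?thesis using that by blast
qed

text \<open>For large \<open>n\<close> every saddle point exceeds the threshold of the estimate in
  \<open>r\<close>, and \<open>r \<ge> ln n / 2\<close> converts the error at the price of the
  factor \<open>2 powr (k / 2)\<close>. The case \<open>v1 = v2\<close> is included, so fixed
  \<open>v\<close> is covered too.\<close>

lemma coeff_asymp_uniform:
  assumes hol: "g holomorphic_on ball 0 1" and gG: "\<And>t. norm t < 1 \<Longrightarrow> g t = G t"
    and v: "0 < v1" "v1 \<le> v2"
  shows "\<exists>C N. \<forall>n\<ge>N. \<forall>v\<in>{v1..v2}. (\<exists>r. saddle_point P v n r) \<and>
    (\<forall>r. saddle_point P v n r \<longrightarrow>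
       (\<exists>\<epsilon>. norm \<epsilon> \<le> C * ln (real n) powr (- real k / 2) \<and>
          fps_nth (fps_expansion (\<lambda>t. exp (of_real v * g t)) 0) n
            = of_real (main_term P v n r) * (1 + \<epsilon>)))"
proof -
  obtain C where C: "C > 0"
    "\<forall>\<^sub>F r in at_top. \<forall>v\<in>{v1..v2}. \<forall>n. saddle_point P v n r \<longrightarrow>
       (\<exists>\<epsilon>. norm \<epsilon> \<le> C * r powr (- real k / 2) \<and>
          fps_nth (fps_expansion (\<lambda>t. exp (of_real v * g t)) 0) n
            = of_real (main_term P v n r) * (1 + \<epsilon>))"
    using coeff_asymp[OF hol gG v] by blast
  then obtain R where R: "\<And>r v n. r \<ge> R \<Longrightarrow> v \<in> {v1..v2} \<Longrightarrow> saddle_point P v n r \<Longrightarrow>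
       (\<exists>\<epsilon>. norm \<epsilon> \<le> C * r powr (- real k / 2) \<and>
          fps_nth (fps_expansion (\<lambda>t. exp (of_real v * g t)) 0) n
            = of_real (main_term P v n r) * (1 + \<epsilon>))"
    unfolding eventually_at_top_linorder by blast
  obtain N where N: "\<And>n v. n \<ge> N \<Longrightarrow> v \<in> {v1..v2} \<Longrightarrow> (\<exists>r. saddle_point P v n r) \<and>
    (\<forall>r. saddle_point P v n r \<longrightarrow> r \<ge> R \<and> ln (real n) \<le> 2 * r)"
    using saddle_points_large[OF v, of R] by blast
  show ?thesis
  proof (rule exI[of _ "C * 2 powr (real k / 2)"], rule exI[of _ "max N 2"], intro allI impI ballI conjI)
    fix n v assume n: "n \<ge> max N 2" and vv: "v \<in> {v1..v2}"
    show "\<exists>r. saddle_point P v n r" using N[of n v] n vv by simp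
    fix r assume saddle: "saddle_point P v n r"
    have r: "r \<ge> R" "ln (real n) / 2 \<le> r" using N[of n v] n vv saddle by auto
    have ln0: "ln (real n) > 0" using n by simp
    obtain \<epsilon> where \<epsilon>: "norm \<epsilon> \<le> C * r powr (- real k / 2)"
      "fps_nth (fps_expansion (\<lambda>t. exp (of_real v * g t)) 0) n = of_real (main_term P v n r) * (1 + \<epsilon>)"
      using R[OF r(1) vv saddle] by blast
    have "r powr (- real k / 2) \<le> (ln (real n) / 2) powr (- real k / 2)"
      using r ln0 by (intro powr_mono2') auto
    also have "\<dots> = 2 powr (real k / 2) * ln (real n) powr (- real k / 2)"
      using ln0 by (simp add: powr_divide powr_minus field_simps)
    finally have "C * r powr (- real k / 2) \<le> C * (2 powr (real k / 2) * ln (real n) powr (- real k / 2))"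
      using C(1) by (intro mult_left_mono) auto
    with \<epsilon>(1) have "norm \<epsilon> \<le> C * 2 powr (real k / 2) * ln (real n) powr (- real k / 2)"
      unfolding mult.assoc by linarith
    with \<epsilon>(2) show "\<exists>\<epsilon>. norm \<epsilon> \<le> C * 2 powr (real k / 2) * ln (real n) powr (- real k / 2) \<and>
        fps_nth (fps_expansion (\<lambda>t. exp (of_real v * g t)) 0) n
          = of_real (main_term P v n r) * (1 + \<epsilon>)"
      by blast
  qed
qed

end

theorem theorem2p5:
  fixes \<theta> :: "nat \<Rightarrow> real" and G :: "complex \<Rightarrow> complex"
    and k :: nat and c :: "nat \<Rightarrow> real" and P :: "real poly"
  assumes nonneg: "\<And>m. m \<ge> 1 \<Longrightarrow> \<theta> m \<ge> 0"
    and radius: "fps_conv_radius (g_fps \<theta>) = 1"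
    and G_cont: "continuous_on (cball 0 1 - {1}) G"
    and G_ext: "\<And>t. norm t < 1 \<Longrightarrow> G t = g_fun \<theta> t"
    and k: "k \<ge> 1"
    and P: "P = monom (1 / real (k + 1)) (k + 1) + (\<Sum>j\<le>k. monom (c j) j)"
    and G_asymp: "(\<lambda>w. G (exp (- w)) - poly (map_poly complex_of_real P) (- Ln w))
                    \<in> O[at 0 within {w. \<bar>Arg w\<bar> \<le> pi / 2}](\<lambda>w. w)"
  shows "(\<forall>v>0. \<exists>C N. \<forall>n\<ge>N.
            (\<exists>r. saddle_point P v n r) \<and>
            (\<forall>r. saddle_point P v n r \<longrightarrow>
               (\<exists>\<epsilon>::complex. norm \<epsilon> \<le> C * ln (real n) powr (- real k / 2) \<and>
                  exp_coeff \<theta> v n = complex_of_real (main_term P v n r) * (1 + \<epsilon>)))) \<and>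
         (\<forall>v1 v2. 1 \<le> v1 \<and> v1 < v2 \<longrightarrow>
            (\<exists>C N. \<forall>n\<ge>N. \<forall>v\<in>{v1..v2}.
              (\<exists>r. saddle_point P v n r) \<and>
              (\<forall>r. saddle_point P v n r \<longrightarrow>
                 (\<exists>\<epsilon>::complex. norm \<epsilon> \<le> C * ln (real n) powr (- real k / 2) \<and>
                    exp_coeff \<theta> v n = complex_of_real (main_term P v n r) * (1 + \<epsilon>)))))"
proof -
  \<comment> \<open>The sum in \<open>P\<close> has degree at most \<open>k\<close>, so it leaves
    the top coefficient untouched.\<close>
  have coeffP: "coeff P (Suc k) = 1 / real (Suc k)" "degree P \<le> Suc k"
    unfolding P
    by (auto simp: coeff_sum intro!: degree_add_le degree_sum_le order_trans[OF degree_monom_le])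
  hence deg: "degree P = Suc k"
    by (intro antisym le_degree) auto
  obtain K where K: "K > 0" "\<forall>\<^sub>F w in at 0 within {w. \<bar>Arg w\<bar> \<le> pi / 2}.
      norm (G (exp (- w)) - cpoly P (- Ln w)) \<le> K * norm w"
    using landau_o.bigE[OF G_asymp] by blast
  then obtain d where d: "d > 0" "\<And>w. \<bar>Arg w\<bar> \<le> pi / 2 \<Longrightarrow> w \<noteq> 0 \<Longrightarrow> norm w < d \<Longrightarrow>
      norm (G (exp (- w)) - cpoly P (- Ln w)) \<le> K * norm w"
    unfolding eventually_at by (auto simp: dist_norm)
  \<comment> \<open>Half of \<open>d\<close> turns the strict condition \<open>norm w < d\<close>
    into a non-strict one. The half plane \<open>Re w > 0\<close> lies in the sector of the
    hypothesis, as its points have argument at most \<open>pi / 2\<close> in absolute value.\<close>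
  interpret log_singularity P k G K "d / 2"
  proof
    show "norm (G (exp (- w)) - cpoly P (- Ln w)) \<le> K * norm w"
      if "Re w > 0" "norm w \<le> d / 2" for w
    proof (rule d(2))
      show "w \<noteq> 0" using that by auto
      thus "\<bar>Arg w\<bar> \<le> pi / 2"
        using that Re_Ln_pos_le[of w] by (simp add: Arg_eq_Im_Ln)
      show "norm w < d" using that d(1) by simp
    qed
  qed (use k deg coeffP K d G_cont in auto)
  have hol: "g_fun \<theta> holomorphic_on ball 0 1"
    unfolding g_fun_def using radius
    by (intro holomorphic_on_eval_fps) (auto simp: eball_def one_ereal_def)
  note main = coeff_asymp_uniform[OF hol G_ext[symmetric], folded exp_coeff_def]
  show ?thesis
  proof (intro conjI allI impI)
    fix v :: real assume "v > 0"
    \<comment> \<open>A single \<open>v\<close> is the degenerate interval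
      \<open>{v..v}\<close>.\<close>
    from main[of v v, OF _ this order_refl] show "\<exists>C N. \<forall>n\<ge>N.
            (\<exists>r. saddle_point P v n r) \<and>
            (\<forall>r. saddle_point P v n r \<longrightarrow>
               (\<exists>\<epsilon>::complex. norm \<epsilon> \<le> C * ln (real n) powr (- real k / 2) \<and>
                  exp_coeff \<theta> v n = complex_of_real (main_term P v n r) * (1 + \<epsilon>)))"
      by simp
  next
    fix v1 v2 :: real assume "1 \<le> v1 \<and> v1 < v2"
    thus "\<exists>C N. \<forall>n\<ge>N. \<forall>v\<in>{v1..v2}.
              (\<exists>r. saddle_point P v n r) \<and>
              (\<forall>r. saddle_point P v n r \<longrightarrow>
                 (\<exists>\<epsilon>::complex. norm \<epsilon> \<le> C * ln (real n) powr (- real k / 2) \<and>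
                    exp_coeff \<theta> v n = complex_of_real (main_term P v n r) * (1 + \<epsilon>)))"
      by (intro main) auto
  qed
qed

end
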